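(* Let $G$ be an amenable group and let $A,B\subset G$ be subsets with $\sigma^R(A)>0$ and $\sigma^R(B)>0$. Then the set $B^{-1}AA^{-1}$ has non-empty interior in the Bohr topology on $G$.
   Context: A group $G$ is amenable if it admits a left-invariant finitely additive probability measure defined on all subsets of $G$. For $A\subset G$, $\sigma^R(A)=\inf_{F}\sup_{y\in G}\frac{|F\cap Ay|}{|F|}$, where $F$ runs over all non-empty finite subsets of $G$. The Bohr topology on a group $G$ is the smallest topology on $G$ for which the canonical homomorphism $\eta:G\to bG$ is continuous, where $(bG,\eta)$ is the Bohr compactification of $G$: $bG$ is a compact Hausdorff topological group and $\eta:G\to bG$ is a homomorphism such that every homomorphism $f:G\to K$ to a compact Hausdorff topological group factors as $f=\bar f\circ\eta$ for a unique continuous homomorphism $\bar f:bG\to K$. Here $B^{-1}AA^{-1}=\{b^{-1}a_1a_2^{-1}:b\in B,\ a_1,a_2\in A\}$. *)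

theory Defs
  imports "HOL-Analysis.Analysis" "HOL-Algebra.Product_Groups"
begin

section \<open>Amenability and the density sigma-R\<close>

definition amenable_group :: "('a, 'm) monoid_scheme \<Rightarrow> bool" where
  "amenable_group G \<longleftrightarrow> group G \<and>
     (\<exists>\<mu> :: 'a set \<Rightarrow> real.
        (\<forall>A. A \<subseteq> carrier G \<longrightarrow> 0 \<le> \<mu> A) \<and>
        \<mu> (carrier G) = 1 \<and>
        (\<forall>A B. A \<subseteq> carrier G \<longrightarrow> B \<subseteq> carrier G \<longrightarrow> A \<inter> B = {} \<longrightarrow> \<mu> (A \<union> B) = \<mu> A + \<mu> B) \<and>
        (\<forall>x A. x \<in> carrier G \<longrightarrow> A \<subseteq> carrier G \<longrightarrow> \<mu> (x <#\<^bsub>G\<^esub> A) = \<mu> A))"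

(* All quotients lie in [0,1] and both index sets are nonempty when G is a group, so the real-valued
   SUP and INF are the genuine supremum and infimum. *)
definition sigma_R :: "('a, 'm) monoid_scheme \<Rightarrow> 'a set \<Rightarrow> real" where
  "sigma_R G A =
     (INF F \<in> {F. finite F \<and> F \<noteq> {} \<and> F \<subseteq> carrier G}.
        SUP y \<in> carrier G. real (card (F \<inter> (A #>\<^bsub>G\<^esub> y))) / real (card F))"


section \<open>Compact Hausdorff groups\<close>

definition topological_group :: "('k, 'm) monoid_scheme \<Rightarrow> 'k topology \<Rightarrow> bool" where
  "topological_group K S \<longleftrightarrow> group K \<and> topspace S = carrier K \<and>
     continuous_map (prod_topology S S) S (\<lambda>(x, y). x \<otimes>\<^bsub>K\<^esub> y) \<and>
     continuous_map S S (\<lambda>x. inv\<^bsub>K\<^esub> x)"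

definition compact_Hausdorff_group :: "('k, 'm) monoid_scheme \<Rightarrow> 'k topology \<Rightarrow> bool" where
  "compact_Hausdorff_group K S \<longleftrightarrow>
     topological_group K S \<and> compact_space S \<and> Hausdorff_space S"

section \<open>Bohr compactification and Bohr topology\<close>

(* Functions are total in HOL, so a homomorphism is unique only up to its values outside the
   carrier; hence the restriction to extensional functions. *)
definition factors_uniquely ::
  "('a, 'm) monoid_scheme \<Rightarrow> 'b monoid \<Rightarrow> 'b topology \<Rightarrow> ('a \<Rightarrow> 'b) \<Rightarrow>
   'k monoid \<Rightarrow> 'k topology \<Rightarrow> ('a \<Rightarrow> 'k) \<Rightarrow> bool" where
  "factors_uniquely G bG T \<eta> K S f \<longleftrightarrow>
     (\<exists>!h. h \<in> hom bG K \<and> h \<in> extensional (carrier bG) \<and> continuous_map T S h \<and>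
           (\<forall>x\<in>carrier G. h (\<eta> x) = f x))"

(* HOL cannot quantify over types, so bG and the test groups K are taken among the groups with
   carrier in the fixed type 'a set set. This type is large enough: a Hausdorff space with a dense
   image of G embeds into it by sending a point to the traces on G of its open neighbourhoods.
   Lemma bohr_compactification_universal shows that the universal property then holds for compact
   Hausdorff groups over every type, and bohr_compactification_exists that bG exists. *)
definition bohr_compactification ::
  "('a, 'm) monoid_scheme \<Rightarrow> 'a set set monoid \<Rightarrow> 'a set set topology \<Rightarrow> ('a \<Rightarrow> 'a set set) \<Rightarrow> bool"
  where
  "bohr_compactification G bG T \<eta> \<longleftrightarrow>
     compact_Hausdorff_group bG T \<and> \<eta> \<in> hom G bG \<and>
     (\<forall>(K :: 'a set set monoid) S f. compact_Hausdorff_group K S \<longrightarrow> f \<in> hom G K \<longrightarrow>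
        factors_uniquely G bG T \<eta> K S f)"

(* The pullback topology is the smallest one making \<eta> continuous; by bohr_topology_eq it does not
   depend on which Bohr compactification is chosen. *)
definition bohr_topology :: "('a, 'm) monoid_scheme \<Rightarrow> 'a topology" where
  "bohr_topology G =
     (SOME X. \<exists>bG T \<eta>. bohr_compactification G bG T \<eta> \<and> X = pullback_topology (carrier G) \<eta> T)"


subsection \<open>Existence, and universality over all types\<close>

lemma compact_Hausdorff_groupD:
  assumes "compact_Hausdorff_group K S"
  shows "group K" "topspace S = carrier K"
    "continuous_map (prod_topology S S) S (\<lambda>(x, y). x \<otimes>\<^bsub>K\<^esub> y)"
    "continuous_map S S (\<lambda>x. inv\<^bsub>K\<^esub> x)" "compact_space S" "Hausdorff_space S"
  using assms by (auto simp: compact_Hausdorff_group_def topological_group_def)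

lemma subgroup_closure_of_hom_image:
  assumes G: "group G" and K: "compact_Hausdorff_group K S" and f: "f \<in> hom G K"
  shows "subgroup (S closure_of (f ` carrier G)) K"
proof -
  note KD = compact_Hausdorff_groupD[OF K]
  interpret G: group G by fact
  interpret K: group K by (rule KD)
  interpret f: group_hom G K f
    using f by unfold_locales
  let ?I = "f ` carrier G"
  let ?C = "S closure_of ?I"
  have sub: "subgroup ?I K"
    by (rule f.img_is_subgroup)
  have I: "?I \<subseteq> topspace S"
    using subgroup.subset[OF sub] KD(2) by simp
  show ?thesis
  proof (rule K.subgroupI)
    show "?C \<subseteq> carrier K"
      using closure_of_subset_topspace[of S ?I] KD(2) by simp
    show "?C \<noteq> {}"
      using closure_of_subset[OF I] by auto
  next
    fix a assume a: "a \<in> ?C"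
    have "(\<lambda>x. inv\<^bsub>K\<^esub> x) ` ?C \<subseteq> S closure_of ((\<lambda>x. inv\<^bsub>K\<^esub> x) ` ?I)"
      by (rule continuous_map_image_closure_subset[OF KD(4)])
    also have "\<dots> \<subseteq> ?C"
      by (rule closure_of_mono) (use subgroup.m_inv_closed[OF sub] in auto)
    finally show "inv\<^bsub>K\<^esub> a \<in> ?C" using a by auto
  next
    fix a b assume ab: "a \<in> ?C" "b \<in> ?C"
    have "(\<lambda>(x, y). x \<otimes>\<^bsub>K\<^esub> y) ` (prod_topology S S closure_of (?I \<times> ?I))
          \<subseteq> S closure_of ((\<lambda>(x, y). x \<otimes>\<^bsub>K\<^esub> y) ` (?I \<times> ?I))"
      by (rule continuous_map_image_closure_subset[OF KD(3)])
    also have "\<dots> \<subseteq> ?C"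
      by (rule closure_of_mono) (use subgroup.m_closed[OF sub] in auto)
    finally show "a \<otimes>\<^bsub>K\<^esub> b \<in> ?C"
      using ab by (auto simp: closure_of_Times)
  qed
qed

(* The closure of the image of G in K, transported to the type 'a set set. *)
lemma hom_reflection:
  fixes G :: "('a, 'm) monoid_scheme" and K :: "'k monoid"
  assumes G: "group G" and K: "compact_Hausdorff_group K S" and f: "f \<in> hom G K"
  obtains K' :: "'a set set monoid" and S' d f' where
    "compact_Hausdorff_group K' S'" "d \<in> hom K' K" "continuous_map S' S d"
    "f' \<in> hom G K'" "\<And>x. x \<in> carrier G \<Longrightarrow> d (f' x) = f x"
    "S' closure_of (f' ` carrier G) = carrier K'"
proof -
  note KD = compact_Hausdorff_groupD[OF K]
  interpret G: group G by fact
  interpret K: group K by (rule KD)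
  interpret f: group_hom G K f
    using f by unfold_locales
  define C where "C = S closure_of (f ` carrier G)"
  have C: "subgroup C K"
    unfolding C_def by (rule subgroup_closure_of_hom_image[OF G K f])
  have Csub: "C \<subseteq> carrier K" using subgroup.subset[OF C] .
  have fC: "f x \<in> C" if "x \<in> carrier G" for x
  proof -
    have "f ` carrier G \<subseteq> topspace S"
      unfolding KD(2) using f.hom_closed by blast
    then show ?thesis
      using closure_of_subset[of "f ` carrier G" S] that unfolding C_def by blast
  qed
  define e where "e x = {carrier G \<inter> f -` U |U. openin S U \<and> x \<in> U}" for x
  have inj: "inj_on e C"
  proof (rule inj_onI, rule ccontr)
    fix x y assume x: "x \<in> C" and y: "y \<in> C" and e: "e x = e y" and xy: "x \<noteq> y"
    have "x \<in> topspace S \<and> y \<in> topspace S \<and> x \<noteq> y"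
      using x y xy Csub KD(2) by auto
    from KD(6)[unfolded Hausdorff_space_def, rule_format, OF this]
    obtain U V where UV: "openin S U" "openin S V" "x \<in> U" "y \<in> V" "disjnt U V"
      by metis
    have "carrier G \<inter> f -` U \<in> e x"
      unfolding e_def by (rule CollectI) (rule exI[of _ U], simp add: UV(1,3))
    then have "carrier G \<inter> f -` U \<in> e y"
      by (simp only: e)
    then have "\<exists>W. carrier G \<inter> f -` U = carrier G \<inter> f -` W \<and> openin S W \<and> y \<in> W"
      unfolding e_def by (rule CollectD)
    then obtain W where W: "openin S W" "y \<in> W" "carrier G \<inter> f -` U = carrier G \<inter> f -` W"
      by (elim exE conjE)
    have "openin S (W \<inter> V)" "y \<in> W \<inter> V" using W UV by auto
    then obtain z where "z \<in> f ` carrier G" "z \<in> W \<inter> V"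
      using y unfolding C_def in_closure_of by blast
    then show False
      using W(3) UV(5) unfolding disjnt_def by blast
  qed
  define d where "d = inv_into C e"
  have de: "d (e x) = x" if "x \<in> C" for x
    using inj that by (simp add: d_def)
  have dC: "d z \<in> C" "e (d z) = z" if "z \<in> e ` C" for z
    using that by (auto simp: d_def inv_into_into f_inv_into_f)
  have dK: "d z \<in> carrier K" if "z \<in> e ` C" for z
    using that dC Csub by blast
  have Cm: "x \<otimes>\<^bsub>K\<^esub> y \<in> C" if "x \<in> C" "y \<in> C" for x y
    using subgroup.m_closed[OF C] that .
  have Ci: "inv\<^bsub>K\<^esub> x \<in> C" if "x \<in> C" for x
    using subgroup.m_inv_closed[OF C] that .
  have C1: "\<one>\<^bsub>K\<^esub> \<in> C" using subgroup.one_closed[OF C] .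
  define K' where "K' = \<lparr>carrier = e ` C, monoid.mult = (\<lambda>x y. e (d x \<otimes>\<^bsub>K\<^esub> d y)), one = e \<one>\<^bsub>K\<^esub>\<rparr>"
  have K'[simp]: "carrier K' = e ` C" "x \<otimes>\<^bsub>K'\<^esub> y = e (d x \<otimes>\<^bsub>K\<^esub> d y)" "\<one>\<^bsub>K'\<^esub> = e \<one>\<^bsub>K\<^esub>" for x y
    by (simp_all add: K'_def)
  have gK': "group K'"
  proof (rule groupI)
    fix x assume "x \<in> carrier K'"
    then show "\<exists>y\<in>carrier K'. y \<otimes>\<^bsub>K'\<^esub> x = \<one>\<^bsub>K'\<^esub>"
      using dK[of x] by (intro bexI[of _ "e (inv\<^bsub>K\<^esub> (d x))"]) (auto simp: de dC Ci)
  qed (use Csub in \<open>auto simp: de dC C1 Cm K.m_assoc subset_iff\<close>)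
  have inv': "inv\<^bsub>K'\<^esub> x = e (inv\<^bsub>K\<^esub> (d x))" if "x \<in> carrier K'" for x
    using that dK[of x] by (intro group.inv_equality[OF gK']) (auto simp: de dC Ci)
  define S' where "S' = pullback_topology (e ` C) d S"
  have tS': "topspace S' = e ` C"
    using dK KD(2) by (auto simp: S'_def topspace_pullback_topology)
  have dcont: "continuous_map S' S d"
    unfolding S'_def using continuous_map_pullback[OF continuous_map_id, of "e ` C" d S] by simp
  have into_S': "continuous_map X S' g"
    if "continuous_map X S (d \<circ> g)" "\<And>x. x \<in> topspace X \<Longrightarrow> g x \<in> e ` C" for X :: "'z topology" and g
    unfolding S'_def using that by (intro continuous_map_pullback') auto
  have "compact_Hausdorff_group K' S'"
    unfolding compact_Hausdorff_group_def topological_group_def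
  proof (intro conjI gK')
    show "topspace S' = carrier K'" by (simp add: tS')
    have "continuous_map (prod_topology S' S') S
            ((\<lambda>(x, y). x \<otimes>\<^bsub>K\<^esub> y) \<circ> (\<lambda>z. (d (fst z), d (snd z))))"
      by (rule continuous_map_compose[OF _ KD(3)])
        (auto intro!: continuous_map_paired[THEN iffD2] continuous_map_compose[OF continuous_map_fst dcont, unfolded comp_def]
          continuous_map_compose[OF continuous_map_snd dcont, unfolded comp_def])
    then have "continuous_map (prod_topology S' S') S (d \<circ> (\<lambda>(x, y). x \<otimes>\<^bsub>K'\<^esub> y))"
      by (rule continuous_map_eq) (auto simp: tS' de dC Cm)
    then show "continuous_map (prod_topology S' S') S' (\<lambda>(x, y). x \<otimes>\<^bsub>K'\<^esub> y)"
      by (rule into_S') (auto simp: tS' de Cm)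
    have "continuous_map S' S ((\<lambda>x. inv\<^bsub>K\<^esub> x) \<circ> d)"
      by (rule continuous_map_compose[OF dcont KD(4)])
    then have "continuous_map S' S (d \<circ> (\<lambda>x. inv\<^bsub>K'\<^esub> x))"
      by (rule continuous_map_eq) (auto simp: tS' inv' de dC Ci)
    then show "continuous_map S' S' (\<lambda>x. inv\<^bsub>K'\<^esub> x)"
      by (rule into_S') (auto simp: tS' inv' de Ci)
    have "compact_space (subtopology S C)"
      unfolding C_def
      by (intro compact_space_subtopology closedin_compact_space KD closedin_closure_of)
    moreover have "continuous_map (subtopology S C) S' e"
    proof (rule into_S')
      have "continuous_map (subtopology S C) S id"
        by (simp add: continuous_map_from_subtopology)
      then show "continuous_map (subtopology S C) S (d \<circ> e)"
        by (rule continuous_map_eq) (auto simp: de)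
    qed auto
    ultimately have "compactin S' (e ` topspace (subtopology S C))"
      using image_compactin compact_space_def by metis
    moreover have "topspace (subtopology S C) = C"
      using Csub KD(2) by auto
    ultimately show "compact_space S'" by (simp add: compact_space_def tS')
    show "Hausdorff_space S'"
      unfolding Hausdorff_space_def
    proof (intro allI impI)
      fix x y assume xy: "x \<in> topspace S' \<and> y \<in> topspace S' \<and> x \<noteq> y"
      then have "d x \<noteq> d y" "d x \<in> topspace S" "d y \<in> topspace S"
        using dC dK KD(2) unfolding tS' by metis+
      then obtain U V where UV: "openin S U" "openin S V" "d x \<in> U" "d y \<in> V" "disjnt U V"
        using KD(6) unfolding Hausdorff_space_def by metis
      then have "openin S' (d -` U \<inter> e ` C)" "openin S' (d -` V \<inter> e ` C)"
        unfolding S'_def openin_pullback_topology by auto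
      then show "\<exists>U V. openin S' U \<and> openin S' V \<and> x \<in> U \<and> y \<in> V \<and> disjnt U V"
        using UV xy unfolding tS' disjnt_def
        by (intro exI[of _ "d -` U \<inter> e ` C"] exI[of _ "d -` V \<inter> e ` C"]) auto
    qed
  qed
  moreover have "d \<in> hom K' K"
    by (rule homI) (auto simp: de Cm subsetD[OF Csub])
  moreover have "(e \<circ> f) \<in> hom G K'"
    by (rule homI) (auto simp: de fC)
  moreover have "d ((e \<circ> f) x) = f x" if "x \<in> carrier G" for x
    using that by (simp add: de fC)
  moreover have "S' closure_of ((e \<circ> f) ` carrier G) = carrier K'"
  proof
    show "S' closure_of ((e \<circ> f) ` carrier G) \<subseteq> carrier K'"
      using closure_of_subset_topspace[of S'] tS' by simp
    show "carrier K' \<subseteq> S' closure_of ((e \<circ> f) ` carrier G)"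
    proof (clarsimp simp: in_closure_of tS')
      fix x V assume x: "x \<in> C" and V: "e x \<in> V" "openin S' V"
      then obtain U where U: "openin S U" "V = d -` U \<inter> e ` C"
        unfolding S'_def openin_pullback_topology by auto
      then have "x \<in> U" using V x de by auto
      then obtain z where "z \<in> f ` carrier G" "z \<in> U"
        using x U(1) unfolding C_def in_closure_of by blast
      then show "\<exists>z\<in>carrier G. e (f z) \<in> V"
        using U(2) fC de by auto
    qed
  qed
  ultimately show ?thesis
    using that dcont by blast
qed

lemma restrict_hom:
  assumes "group G" "h \<in> hom G K"
  shows "restrict h (carrier G) \<in> hom G K"
  using assms by (auto simp: hom_def group.is_monoid monoid.m_closed)

lemma factors_uniquelyI_dense:
  assumes bG: "compact_Hausdorff_group bG T" and K: "compact_Hausdorff_group K S"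
    and dense: "T closure_of (\<eta> ` carrier G) = carrier bG"
    and h: "h \<in> hom bG K" "continuous_map T S h" "\<And>x. x \<in> carrier G \<Longrightarrow> h (\<eta> x) = f x"
    and \<eta>: "\<eta> \<in> hom G bG"
  shows "factors_uniquely G bG T \<eta> K S f"
  unfolding factors_uniquely_def
proof (rule ex1I)
  note bD = compact_Hausdorff_groupD[OF bG]
  let ?h = "restrict h (carrier bG)"
  have "continuous_map T S ?h"
    by (rule continuous_map_eq[OF h(2)]) (simp add: bD)
  then show "?h \<in> hom bG K \<and> ?h \<in> extensional (carrier bG) \<and> continuous_map T S ?h \<and>
      (\<forall>x\<in>carrier G. ?h (\<eta> x) = f x)"
    using restrict_hom[OF bD(1) h(1)] h(3) \<eta> by (auto simp: hom_def)
  fix g assume g: "g \<in> hom bG K \<and> g \<in> extensional (carrier bG) \<and> continuous_map T S g \<and>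
      (\<forall>x\<in>carrier G. g (\<eta> x) = f x)"
  have "g x = h x" if "x \<in> carrier bG" for x
    using that dense g h compact_Hausdorff_groupD[OF K]
    by (intro forall_in_closure_of_eq[of x T "\<eta> ` carrier G" S g h]) auto
  then show "g = ?h"
    using g by (intro extensionalityI[of _ "carrier bG"]) auto
qed

lemma compact_Hausdorff_group_product:
  assumes "\<And>i. i \<in> I \<Longrightarrow> compact_Hausdorff_group (K i) (S i)"
  shows "compact_Hausdorff_group (product_group I K) (product_topology S I)"
  unfolding compact_Hausdorff_group_def topological_group_def
proof (intro conjI)
  note D = compact_Hausdorff_groupD[OF assms]
  let ?P = "product_topology S I"
  have tP: "topspace ?P = (\<Pi>\<^sub>E i\<in>I. carrier (K i))"
    using D(2) by (auto simp: PiE_iff)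
  show "group (product_group I K)" using D(1) by simp
  show "topspace ?P = carrier (product_group I K)" using tP by simp
  show "compact_space ?P" using D(5) by (simp add: compact_space_product_topology)
  show "Hausdorff_space ?P" using D(6) by (simp add: Hausdorff_space_product_topology)
  show "continuous_map (prod_topology ?P ?P) ?P (\<lambda>(x, y). x \<otimes>\<^bsub>product_group I K\<^esub> y)"
    unfolding continuous_map_componentwise
  proof (intro conjI ballI)
    fix i assume i: "i \<in> I"
    have "continuous_map (prod_topology ?P ?P) (S i)
            ((\<lambda>(x, y). x \<otimes>\<^bsub>K i\<^esub> y) \<circ> (\<lambda>z. (fst z i, snd z i)))"
      by (rule continuous_map_compose[OF _ D(3)[OF i]])
        (auto intro!: continuous_map_paired[THEN iffD2]
          continuous_map_compose[OF continuous_map_fst continuous_map_product_projection[OF i, of S], unfolded comp_def]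
          continuous_map_compose[OF continuous_map_snd continuous_map_product_projection[OF i, of S], unfolded comp_def])
    then show "continuous_map (prod_topology ?P ?P) (S i)
        (\<lambda>z. (case z of (x, y) \<Rightarrow> x \<otimes>\<^bsub>product_group I K\<^esub> y) i)"
      by (rule continuous_map_eq) (auto simp: i)
  qed auto
  have "continuous_map ?P ?P (\<lambda>x. \<lambda>i\<in>I. inv\<^bsub>K i\<^esub> (x i))"
    unfolding continuous_map_componentwise
  proof (intro conjI ballI)
    fix i assume i: "i \<in> I"
    have "continuous_map ?P (S i) ((\<lambda>x. inv\<^bsub>K i\<^esub> x) \<circ> (\<lambda>x. x i))"
      by (rule continuous_map_compose[OF continuous_map_product_projection[OF i, of S] D(4)[OF i]])
    then show "continuous_map ?P (S i) (\<lambda>x. (\<lambda>i\<in>I. inv\<^bsub>K i\<^esub> (x i)) i)"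
      by (rule continuous_map_eq) (auto simp: i)
  qed auto
  then show "continuous_map ?P ?P (\<lambda>x. inv\<^bsub>product_group I K\<^esub> x)"
    by (rule continuous_map_eq) (use D(1) in \<open>simp add: tP del: topspace_product_topology\<close>)
qed

lemma bohr_compactification_exists_strong:
  fixes G :: "('a, 'm) monoid_scheme"
  assumes G: "group G"
  obtains bG T \<eta> where "bohr_compactification G bG T \<eta>" "T closure_of (\<eta> ` carrier G) = carrier bG"
proof -
  define I where "I = {(K :: 'a set set monoid, S, f). compact_Hausdorff_group K S \<and>
      f \<in> hom G K}"
  define P where "P = product_group I (\<lambda>(K, S, f). K)"
  define X where "X = product_topology (\<lambda>(K, S, f). S) I"
  define j where "j x = (\<lambda>(K, S, f)\<in>I. f x)" for x
  have P: "compact_Hausdorff_group P X"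
    unfolding P_def X_def by (rule compact_Hausdorff_group_product) (auto simp: I_def)
  have j: "j \<in> hom G P"
  proof (rule homI)
    show "j x \<in> carrier P" if "x \<in> carrier G" for x
      using that by (auto simp: P_def j_def I_def hom_def)
    show "j (x \<otimes>\<^bsub>G\<^esub> y) = j x \<otimes>\<^bsub>P\<^esub> j y" if "x \<in> carrier G" "y \<in> carrier G" for x y
      using that by (auto simp: P_def j_def I_def hom_def fun_eq_iff)
  qed
  obtain bG :: "'a set set monoid" and T d \<eta> where
    bG: "compact_Hausdorff_group bG T" and d: "d \<in> hom bG P" "continuous_map T X d"
    and \<eta>: "\<eta> \<in> hom G bG" "\<And>x. x \<in> carrier G \<Longrightarrow> d (\<eta> x) = j x"
    and dense: "T closure_of (\<eta> ` carrier G) = carrier bG"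
    by (rule hom_reflection[OF G P j]) blast
  have "factors_uniquely G bG T \<eta> K S f"
    if K: "compact_Hausdorff_group K S" and f: "f \<in> hom G K" for K :: "'a set set monoid" and S f
  proof (rule factors_uniquelyI_dense[OF bG K dense _ _ _ \<eta>(1)])
    have i: "(K, S, f) \<in> I" using K f by (simp add: I_def)
    let ?h = "\<lambda>z. d z (K, S, f)"
    show "?h \<in> hom bG K"
    proof (rule homI)
      show "?h x \<in> carrier K" if "x \<in> carrier bG" for x
        using hom_in_carrier[OF d(1) that] i by (force simp: P_def PiE_iff)
      show "?h (x \<otimes>\<^bsub>bG\<^esub> y) = ?h x \<otimes>\<^bsub>K\<^esub> ?h y" if "x \<in> carrier bG" "y \<in> carrier bG" for x y
        using hom_mult[OF d(1) that] i by (simp add: P_def)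
    qed
    show "continuous_map T S ?h"
      using continuous_map_compose[OF d(2)[unfolded X_def] continuous_map_product_projection[OF i]]
      by (simp add: comp_def)
    show "?h (\<eta> x) = f x" if "x \<in> carrier G" for x
      using \<eta>(2)[OF that] i by (simp add: j_def)
  qed
  then have "bohr_compactification G bG T \<eta>"
    using bG \<eta>(1) by (simp add: bohr_compactification_def)
  then show ?thesis using that dense by blast
qed

theorem bohr_compactification_exists:
  assumes "group G"
  shows "\<exists>bG T \<eta>. bohr_compactification G bG T \<eta>"
  by (rule bohr_compactification_exists_strong[OF assms]) blast

lemma bohr_compactificationD:
  fixes K :: "'a set set monoid"
  assumes "bohr_compactification G bG T (\<eta> :: 'a \<Rightarrow> _)"
  shows "compact_Hausdorff_group bG T" "\<eta> \<in> hom G bG"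
    "compact_Hausdorff_group K S \<Longrightarrow> f \<in> hom G K \<Longrightarrow> factors_uniquely G bG T \<eta> K S f"
  using assms by (auto simp: bohr_compactification_def)

lemma factors_uniquely_ex:
  assumes "factors_uniquely G bG T \<eta> K S f"
  obtains h where "h \<in> hom bG K" "h \<in> extensional (carrier bG)" "continuous_map T S h"
    "\<And>x. x \<in> carrier G \<Longrightarrow> h (\<eta> x) = f x"
  using assms unfolding factors_uniquely_def by blast

lemma bohr_compactification_dense:
  fixes G :: "('a, 'm) monoid_scheme"
  assumes G: "group G" and b: "bohr_compactification G bG T \<eta>"
  shows "T closure_of (\<eta> ` carrier G) = carrier bG"
proof -
  note bD = bohr_compactificationD[OF b]
  note tD = compact_Hausdorff_groupD[OF bD(1)]
  obtain bG0 T0 \<eta>0 where b0: "bohr_compactification G bG0 T0 \<eta>0"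
    and dense: "T0 closure_of (\<eta>0 ` carrier G) = carrier bG0"
    by (rule bohr_compactification_exists_strong[OF G])
  note b0D = bohr_compactificationD[OF b0]
  note t0D = compact_Hausdorff_groupD[OF b0D(1)]
  obtain p where p: "p \<in> hom bG bG0" "continuous_map T T0 p" "\<And>x. x \<in> carrier G \<Longrightarrow> p (\<eta> x) = \<eta>0 x"
    using factors_uniquely_ex[OF bD(3)[OF b0D(1,2)]] by metis
  obtain q where q: "q \<in> hom bG0 bG" "continuous_map T0 T q" "\<And>x. x \<in> carrier G \<Longrightarrow> q (\<eta>0 x) = \<eta> x"
    using factors_uniquely_ex[OF b0D(3)[OF bD(1,2)]] by metis
  let ?r = "restrict (q \<circ> p) (carrier bG)" and ?i = "restrict id (carrier bG)"
  have \<eta>: "\<eta> x \<in> carrier bG" if "x \<in> carrier G" for x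
    using that bD(2) by (auto simp: hom_def)
  have "continuous_map T T ?r" "continuous_map T T ?i"
    using continuous_map_eq[OF continuous_map_compose[OF p(2) q(2)], of ?r]
      continuous_map_eq[OF continuous_map_id, of T ?i] by (simp_all add: tD)
  moreover have "?r \<in> hom bG bG" "?i \<in> hom bG bG"
    using restrict_hom[OF tD(1) hom_compose[OF p(1) q(1)]] restrict_hom[OF tD(1), of id bG]
    by (simp_all add: hom_def)
  moreover have "\<forall>x\<in>carrier G. ?r (\<eta> x) = \<eta> x" "\<forall>x\<in>carrier G. ?i (\<eta> x) = \<eta> x"
    using p(3) q(3) \<eta> by auto
  ultimately have "?r = ?i"
    using bD(3)[OF bD(1,2)] unfolding factors_uniquely_def
    by (blast intro: restrict_extensional)
  then have qp: "q (p x) = x" if "x \<in> carrier bG" for x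
    using that by (metis comp_apply id_apply restrict_apply')
  have "carrier bG \<subseteq> q ` carrier bG0"
    using qp hom_in_carrier[OF p(1)] by (metis image_eqI subsetI)
  also have "\<dots> \<subseteq> T closure_of (q ` \<eta>0 ` carrier G)"
    using continuous_map_image_closure_subset[OF q(2), of "\<eta>0 ` carrier G"] dense by simp
  also have "q ` \<eta>0 ` carrier G = \<eta> ` carrier G"
    using q(3) by (force simp: image_iff)
  finally show ?thesis
    using closure_of_subset_topspace[of T] tD(2) by auto
qed

theorem bohr_compactification_universal:
  fixes G :: "('a, 'm) monoid_scheme" and K :: "'k monoid"
  assumes G: "group G" and b: "bohr_compactification G bG T \<eta>"
    and K: "compact_Hausdorff_group K S" and f: "f \<in> hom G K"
  shows "factors_uniquely G bG T \<eta> K S f"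
proof -
  note bD = bohr_compactificationD[OF b]
  obtain K' :: "'a set set monoid" and S' d f' where
    K': "compact_Hausdorff_group K' S'" and d: "d \<in> hom K' K" "continuous_map S' S d"
    and f': "f' \<in> hom G K'" "\<And>x. x \<in> carrier G \<Longrightarrow> d (f' x) = f x"
    by (rule hom_reflection[OF G K f]) blast
  obtain h where h: "h \<in> hom bG K'" "continuous_map T S' h" "\<And>x. x \<in> carrier G \<Longrightarrow> h (\<eta> x) = f' x"
    using factors_uniquely_ex[OF bD(3)[OF K' f'(1)]] by metis
  show ?thesis
    by (rule factors_uniquelyI_dense[OF bD(1) K bohr_compactification_dense[OF G b], of "d \<circ> h"])
      (use h f'(2) d bD(2) in \<open>auto intro: hom_compose continuous_map_compose\<close>)
qed

lemma bohr_pullback_subset: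
  assumes b1: "bohr_compactification G bG1 T1 \<eta>1" and b2: "bohr_compactification G bG2 T2 \<eta>2"
    and U: "openin (pullback_topology (carrier G) \<eta>2 T2) U"
  shows "openin (pullback_topology (carrier G) \<eta>1 T1) U"
proof -
  note D1 = bohr_compactificationD[OF b1] and D2 = bohr_compactificationD[OF b2]
  obtain h where h: "h \<in> hom bG1 bG2" "continuous_map T1 T2 h"
    "\<And>x. x \<in> carrier G \<Longrightarrow> h (\<eta>1 x) = \<eta>2 x"
    using factors_uniquely_ex[OF D1(3)[OF D2(1,2)]] by metis
  obtain V where V: "openin T2 V" "U = \<eta>2 -` V \<inter> carrier G"
    using U by (auto simp: openin_pullback_topology)
  have "openin T1 {x \<in> topspace T1. h x \<in> V}"
    using h(2) V(1) by (rule openin_continuous_map_preimage)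
  moreover have "\<eta>1 x \<in> topspace T1" if "x \<in> carrier G" for x
    using that D1(2) compact_Hausdorff_groupD(2)[OF D1(1)] by (auto simp: hom_def)
  then have "U = \<eta>1 -` {x \<in> topspace T1. h x \<in> V} \<inter> carrier G"
    using V(2) h(3) by auto
  ultimately show ?thesis
    unfolding openin_pullback_topology by blast
qed

theorem bohr_topology_eq:
  assumes b: "bohr_compactification G bG T \<eta>"
  shows "bohr_topology G = pullback_topology (carrier G) \<eta> T"
  unfolding bohr_topology_def
proof (rule some_equality)
  show "\<exists>bG' T' \<eta>'. bohr_compactification G bG' T' \<eta>' \<and>
      pullback_topology (carrier G) \<eta> T = pullback_topology (carrier G) \<eta>' T'"
    using b by blast
next
  fix X assume "\<exists>bG' T' \<eta>'. bohr_compactification G bG' T' \<eta>' \<and>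
      X = pullback_topology (carrier G) \<eta>' T'"
  then show "X = pullback_topology (carrier G) \<eta> T"
    using bohr_pullback_subset b by (metis topology_eq)
qed

end

theory Submission
  imports Defs "HOL-Probability.Discrete_Topology"
begin

text \<open>
For a left-invariant mean \<open>\<mu>\<close> with \<open>\<mu>(A) > 0\<close> put \<open>\<phi>(g) = \<mu>(A \<inter> gA)\<close>, and for a left-invariant
mean \<open>\<nu>\<close> with \<open>\<nu>(B) > 0\<close> let \<open>\<psi>(g)\<close> be the \<open>\<nu>\<close>-mean over \<open>b\<close> of \<open>1\<^sub>B(b) \<phi>(bg)\<close>. If \<open>\<psi>(g) > 0\<close>, then
some \<open>b \<in> B\<close> has \<open>A \<inter> bgA \<noteq> {}\<close>, and so \<open>g\<close> lies in \<open>B\<inverse>AA\<inverse>\<close> (\<open>psi_pos_imp_mem\<close>). It is therefore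
enough that \<open>\<psi>\<close> is positive at some point and continuous for the Bohr topology.

Continuity. The function \<open>\<phi>\<close> is positive definite, hence the sum of an almost periodic function and
one of mean square zero, and only the first summand contributes to \<open>\<psi>\<close>. The proof reaches this
conclusion without the decomposition and without completing a Hilbert space. In the semi-inner product
of \<open>\<nu>\<close>, the value \<open>\<psi>(g)\<close> is the product of \<open>1\<^sub>B\<close> with the translate \<open>x \<mapsto> \<phi>(xg)\<close>. Replacing \<open>1\<^sub>B\<close> by
a nearly orthogonal projection to the span of all these translates changes this product by little,
uniformly in \<open>g\<close>, so \<open>\<psi>\<close> is a uniform limit of combinations of functions \<open>\<Phi>(h, \<cdot>)\<close>, where \<open>\<Phi>(a, b)\<close>
is the \<open>\<nu>\<close>-mean over \<open>x\<close> of \<open>\<phi>(xa) \<phi>(xb)\<close> (\<open>psi_near_Phi_span\<close>). The kernel \<open>\<Phi>\<close> is a uniform limit of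
kernels of finite rank and satisfies \<open>\<Phi>(ya, yb) = \<Phi>(a, b)\<close>; together these make \<open>\<Phi>(h, \<cdot>)\<close>, and with it
\<open>\<psi>\<close>, almost periodic. Both properties of \<open>\<Phi>\<close> come from the mean ergodic theorem in a quantitative form: a
convex combination of the vectors of a family whose norm is almost minimal is almost fixed by every
isometry that permutes the family (\<open>near_minimal_average\<close>), here applied to
\<open>(y, z) \<mapsto> 1\<^sub>A(xy) 1\<^sub>A(xz)\<close> and the mean \<open>\<mu> \<times> \<mu>\<close>. Finally, the two-sided translates of an almost periodic
function form a totally bounded set in the uniform metric, and the group structure of \<open>G\<close> extends to
the closure of that set. The closure is a compact group, so by the universal property of \<open>bG\<close> the balls
of its metric have preimages in \<open>G\<close> that are open in the Bohr topology
(\<open>almost_periodic_bohr_interior\<close>).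

Positivity. By the same approximation finitely many translates of \<open>\<phi>\<close> have an average which is bounded
below by a positive constant on all of \<open>G\<close>, since \<open>\<Phi>(1, 1) \<ge> \<mu>(A)^4\<close>. Hence the sum of finitely many
values of \<open>\<psi>\<close> is at least a positive multiple of \<open>\<nu>(B)\<close> (\<open>psi_pos_somewhere\<close>).

The means. If \<open>F\<close> is an almost left-invariant finite set and \<open>|F \<inter> Ay| \<ge> c |F|\<close>, then averaging over
\<open>F y\<inverse>\<close> is an almost left-invariant mean that gives \<open>A\<close> at least \<open>c\<close>, and a limit of such
averages exists by Tychonoff's theorem (\<open>sigma_R_pos_imp_invariant_mean\<close>). Almost invariant finite
sets exist, because otherwise Hall's marriage theorem produces a paradoxical decomposition of \<open>G\<close>
(\<open>amenable_folner\<close>).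
\<close>

section \<open>Hall's theorem for infinite locally finite relations\<close>

text \<open>
Rado's proof, which treats infinite \<open>I\<close> at once. Shrink the relation as long as Hall's condition
survives; a minimal relation exists by Zorn's lemma because every \<open>R `` {i}\<close> is finite. If some \<open>i\<close>
still had two values \<open>x \<noteq> y\<close>, deleting either pair would violate the condition, and adding the two
violated inequalities contradicts the condition for \<open>insert i (J \<union> K)\<close> and \<open>J \<inter> K\<close>. So the minimal relation
is a function, and Hall's condition for two-element sets makes it injective.
\<close>

lemma hall_locally_finite:
  fixes R :: "('i \<times> 'x) set"
  assumes fin: "\<And>i. i \<in> I \<Longrightarrow> finite (R `` {i})"
    and hall: "\<And>J. finite J \<Longrightarrow> J \<subseteq> I \<Longrightarrow> card J \<le> card (R `` J)"
  obtains h where "inj_on h I" "\<And>i. i \<in> I \<Longrightarrow> (i, h i) \<in> R"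
proof -
  define \<D> where "\<D> = {D. D \<subseteq> R \<and> (\<forall>J. finite J \<longrightarrow> J \<subseteq> I \<longrightarrow> card J \<le> card ((R - D) `` J))}"
  have finJ: "finite (R `` J)" if "finite J" "J \<subseteq> I" for J
  proof -
    have "R `` J = (\<Union>i\<in>J. R `` {i})" by auto
    then show ?thesis using that fin by auto
  qed
  have "{} \<in> \<D>" using hall by (simp add: \<D>_def)
  moreover have "\<Union>\<C> \<in> \<D>" if "\<C> \<noteq> {}" and chain: "subset.chain \<D> \<C>" for \<C>
  proof -
    have "\<Union>\<C> \<subseteq> R" using chain by (auto simp: subset.chain_def \<D>_def)
    moreover have "card J \<le> card ((R - \<Union>\<C>) `` J)" if J: "finite J" "J \<subseteq> I" for J
    proof -
      \<comment> \<open>Only finitely many deletions concern J, so one member of the chain contains them all.\<close>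
      have "finite (\<Union>\<C> \<inter> J \<times> R `` J)"
        using finJ J by (intro finite_Int) auto
      then obtain D where D: "D \<in> \<C>" "\<Union>\<C> \<inter> J \<times> R `` J \<subseteq> D"
        using finite_subset_Union_chain[OF _ _ \<open>\<C> \<noteq> {}\<close> chain, of "\<Union>\<C> \<inter> J \<times> R `` J"] by blast
      have "(R - \<Union>\<C>) `` J = (R - D) `` J"
        using D by fastforce
      then show ?thesis
        using D(1) chain J by (auto simp: subset.chain_def \<D>_def)
    qed
    ultimately show ?thesis by (auto simp: \<D>_def)
  qed
  ultimately obtain D where D: "D \<in> \<D>" and max: "\<And>X. X \<in> \<D> \<Longrightarrow> D \<subseteq> X \<Longrightarrow> X = D"
    using subset_Zorn_nonempty[of \<D>] by blast
  define S where "S = R - D"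
  have hallS: "card J \<le> card (S `` J)" if "finite J" "J \<subseteq> I" for J
    using D that by (auto simp: \<D>_def S_def)
  have finS: "finite (S `` J)" if "finite J" "J \<subseteq> I" for J
    using finJ[OF that] by (rule finite_subset[rotated]) (auto simp: S_def)
  have tight: "\<exists>J. finite J \<and> J \<subseteq> I \<and> i \<notin> J \<and> card (S `` J \<union> (S `` {i} - {x})) \<le> card J"
    if i: "i \<in> I" and x: "(i, x) \<in> S" for i x
  proof -
    have "insert (i, x) D \<notin> \<D>"
      using max[of "insert (i, x) D"] x by (auto simp: S_def)
    moreover have "insert (i, x) D \<subseteq> R" using D x by (auto simp: \<D>_def S_def)
    moreover have "R - insert (i, x) D = S - {(i, x)}" by (auto simp: S_def)
    ultimately obtain J where J: "finite J" "J \<subseteq> I" "card ((S - {(i, x)}) `` J) < card J"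
      by (auto simp: \<D>_def not_le)
    have "i \<in> J"
    proof (rule ccontr)
      assume "i \<notin> J"
      then have "(S - {(i, x)}) `` J = S `` J" by auto
      then show False using J hallS[of J] by simp
    qed
    moreover have "S `` (J - {i}) \<union> (S `` {i} - {x}) = (S - {(i, x)}) `` J \<union> S `` (J - {i})"
      using \<open>i \<in> J\<close> by auto
    moreover have "\<dots> = (S - {(i, x)}) `` J" by auto
    ultimately show ?thesis
      using J by (intro exI[of _ "J - {i}"]) auto
  qed
  have uniq: "x = y" if i: "i \<in> I" and x: "(i, x) \<in> S" and y: "(i, y) \<in> S" for i x y
  proof (rule ccontr)
    assume "x \<noteq> y"
    obtain J where J: "finite J" "J \<subseteq> I" "i \<notin> J" "card (S `` J \<union> (S `` {i} - {x})) \<le> card J"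
      using tight[OF i x] by blast
    obtain K where K: "finite K" "K \<subseteq> I" "i \<notin> K" "card (S `` K \<union> (S `` {i} - {y})) \<le> card K"
      using tight[OF i y] by blast
    let ?P = "S `` J \<union> (S `` {i} - {x})" and ?Q = "S `` K \<union> (S `` {i} - {y})"
    have fP: "finite ?P" and fQ: "finite ?Q"
      using finS J K i by auto
    have "card (insert i (J \<union> K)) \<le> card (S `` (insert i (J \<union> K)))"
      using J K i by (intro hallS) auto
    also have "\<dots> \<le> card (?P \<union> ?Q)"
      using fP fQ \<open>x \<noteq> y\<close> by (intro card_mono) auto
    finally have 1: "Suc (card (J \<union> K)) \<le> card (?P \<union> ?Q)"
      using J K by simp
    have "card (J \<inter> K) \<le> card (S `` (J \<inter> K))"
      using J K by (intro hallS) auto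
    also have "\<dots> \<le> card (?P \<inter> ?Q)"
      using fP by (intro card_mono) auto
    finally have 2: "card (J \<inter> K) \<le> card (?P \<inter> ?Q)" .
    show False
      using 1 2 J(4) K(4) card_Un_Int[OF fP fQ] card_Un_Int[OF J(1) K(1)] by linarith
  qed
  have ex: "\<exists>x. (i, x) \<in> S" if "i \<in> I" for i
    using hallS[of "{i}"] that by (cases "S `` {i} = {}") auto
  define h where "h i = (SOME x. (i, x) \<in> S)" for i
  have h: "(i, h i) \<in> S" if "i \<in> I" for i
    unfolding h_def using ex[OF that] by (rule someI_ex)
  have "inj_on h I"
  proof (rule inj_onI, rule ccontr)
    fix i j assume ij: "i \<in> I" "j \<in> I" "h i = h j" "i \<noteq> j"
    have "x = h i" if "k \<in> {i, j}" "(k, x) \<in> S" for k x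
      using uniq[of k x "h k"] h[of k] that ij by auto
    then have "S `` {i, j} \<subseteq> {h i}" by blast
    then have "card (S `` {i, j}) \<le> 1"
      using card_mono[of "{h i}"] by simp
    then show False
      using hallS[of "{i, j}"] ij by simp
  qed
  then show ?thesis
    using that h by (auto simp: S_def)
qed

section \<open>Amenable groups have Folner sets\<close>

lemma finitely_additive_UN:
  fixes \<mu> :: "'a set \<Rightarrow> real"
  assumes add: "\<And>A B. A \<subseteq> X \<Longrightarrow> B \<subseteq> X \<Longrightarrow> A \<inter> B = {} \<Longrightarrow> \<mu> (A \<union> B) = \<mu> A + \<mu> B"
    and "finite I" "\<And>i. i \<in> I \<Longrightarrow> A i \<subseteq> X" "disjoint_family_on A I"
  shows "\<mu> (\<Union>i\<in>I. A i) = (\<Sum>i\<in>I. \<mu> (A i))"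
  using assms(2-)
proof (induction I)
  case empty
  then show ?case using add[of "{}" "{}"] by simp
next
  case (insert i I)
  have "A i \<inter> (\<Union>j\<in>I. A j) = {}"
    using insert.prems(2) insert.hyps by (auto simp: disjoint_family_on_def)
  then have "\<mu> (A i \<union> (\<Union>j\<in>I. A j)) = \<mu> (A i) + \<mu> (\<Union>j\<in>I. A j)"
    using insert.prems by (intro add) auto
  then show ?case
    using insert by (auto simp: disjoint_family_on_def)
qed

lemma amenable_group_imp_group: "amenable_group G \<Longrightarrow> group G"
  unfolding amenable_group_def by (rule conjunct1)

text \<open>
If \<open>T\<close> doubled every finite set, Hall's theorem would give an injection \<open>h\<close> from two copies of \<open>G\<close>
to \<open>G\<close> with \<open>h (x, b) \<in> T x\<close>. Cutting each copy into the pieces on which \<open>h\<close> is left multiplication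
by a fixed \<open>t \<in> T\<close> yields a paradoxical decomposition: the translated pieces are disjoint in \<open>G\<close>, but
their measures add up to \<open>2\<close>.
\<close>

lemma amenable_not_doubling:
  assumes am: "amenable_group G" and T: "finite T" "T \<subseteq> carrier G"
  shows "\<exists>F. finite F \<and> F \<subseteq> carrier G \<and> card (T <#>\<^bsub>G\<^esub> F) < 2 * card F"
proof (rule ccontr)
  assume *: "\<not> ?thesis"
  have doubling: "2 * card F \<le> card (T <#>\<^bsub>G\<^esub> F)" if "finite F" "F \<subseteq> carrier G" for F
    using that * by (meson not_le)
  obtain \<mu> :: "'a set \<Rightarrow> real" where \<mu>:
    "(\<forall>A. A \<subseteq> carrier G \<longrightarrow> 0 \<le> \<mu> A) \<and> \<mu> (carrier G) = 1 \<and>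
     (\<forall>A B. A \<subseteq> carrier G \<longrightarrow> B \<subseteq> carrier G \<longrightarrow> A \<inter> B = {} \<longrightarrow> \<mu> (A \<union> B) = \<mu> A + \<mu> B) \<and>
     (\<forall>x A. x \<in> carrier G \<longrightarrow> A \<subseteq> carrier G \<longrightarrow> \<mu> (x <#\<^bsub>G\<^esub> A) = \<mu> A)"
    using conjunct2[OF am[unfolded amenable_group_def]] by (elim exE) (rule that)
  have pos: "0 \<le> \<mu> A" if "A \<subseteq> carrier G" for A
    using \<mu> that by simp
  have one: "\<mu> (carrier G) = 1"
    using \<mu> by simp
  have add: "\<mu> (A \<union> B) = \<mu> A + \<mu> B" if "A \<subseteq> carrier G" "B \<subseteq> carrier G" "A \<inter> B = {}" for A B
    using \<mu> that by simp
  have inv: "\<mu> (x <#\<^bsub>G\<^esub> A) = \<mu> A" if "x \<in> carrier G" "A \<subseteq> carrier G" for x A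
    using \<mu> that by simp
  interpret group G by (rule amenable_group_imp_group[OF am])
  define I where "I = carrier G \<times> (UNIV :: bool set)"
  define R where "R = {((x, b), t \<otimes>\<^bsub>G\<^esub> x) | x (b :: bool) t. x \<in> carrier G \<and> t \<in> T}"
  have img: "R `` J = T <#>\<^bsub>G\<^esub> (fst ` J)" if "J \<subseteq> I" for J
  proof -
    have "y \<in> R `` J \<longleftrightarrow> (\<exists>x b t. (x, b) \<in> J \<and> t \<in> T \<and> y = t \<otimes>\<^bsub>G\<^esub> x)" for y
      using that unfolding R_def I_def Image_iff by blast
    then show ?thesis by (force simp: set_mult_def)
  qed
  have "card J \<le> card (R `` J)" if J: "finite J" "J \<subseteq> I" for J
  proof -
    have "card J \<le> card (fst ` J \<times> (UNIV :: bool set))"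
      using J by (intro card_mono) force+
    also have "\<dots> \<le> card (T <#>\<^bsub>G\<^esub> (fst ` J))"
    proof -
      have "fst ` J \<subseteq> carrier G" using J by (auto simp: I_def)
      then show ?thesis
        using doubling[of "fst ` J"] J by (simp add: card_cartesian_product mult.commute)
    qed
    finally show ?thesis using img J by simp
  qed
  moreover have "finite (R `` {i})" if "i \<in> I" for i
    using img[of "{i}"] that T by (simp add: set_mult_def)
  ultimately obtain h where h: "inj_on h I" "\<And>i. i \<in> I \<Longrightarrow> (i, h i) \<in> R"
    using hall_locally_finite[of I R] by blast
  define P where "P b t = {x \<in> carrier G. h (x, b) = t \<otimes>\<^bsub>G\<^esub> x}" for b t
  have PG: "P b t \<subseteq> carrier G" for b t
    by (auto simp: P_def)
  have coset: "t <#\<^bsub>G\<^esub> P b t \<subseteq> carrier G" if "t \<in> T" for b t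
    using l_coset_subset_G[OF PG, of t] T that by blast
  have cover: "(\<Union>t\<in>T. P b t) = carrier G" for b
    using h(2) by (fastforce simp: P_def I_def R_def)
  have disj1: "disjoint_family_on (P b) T" for b
    unfolding disjoint_family_on_def P_def using T by (auto simp: subset_iff)
  have disj2: "disjoint_family_on (\<lambda>(b, t). t <#\<^bsub>G\<^esub> P b t) (UNIV \<times> T)"
  proof -
    have "(b, t) = (c, s)"
      if "t \<in> T" "s \<in> T" "y \<in> t <#\<^bsub>G\<^esub> P b t" "y \<in> s <#\<^bsub>G\<^esub> P c s" for b c s t y
    proof -
      obtain x x' where x: "x \<in> P b t" "y = t \<otimes>\<^bsub>G\<^esub> x" and x': "x' \<in> P c s" "y = s \<otimes>\<^bsub>G\<^esub> x'"
        using \<open>y \<in> t <#\<^bsub>G\<^esub> P b t\<close> \<open>y \<in> s <#\<^bsub>G\<^esub> P c s\<close> unfolding l_coset_def by blast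
      then have "h (x, b) = h (x', c)" "(x, b) \<in> I" "(x', c) \<in> I"
        by (auto simp: P_def I_def)
      then have "x = x'" "b = c" using h(1) by (auto dest: inj_onD)
      moreover have "t = s"
        using \<open>x = x'\<close> x x' T that unfolding P_def by (metis (no_types, lifting) mem_Collect_eq right_cancel subsetD)
      ultimately show ?thesis by simp
    qed
    then have *: "(b, t) = (c, s)"
      if "t \<in> T" "s \<in> T" "(t <#\<^bsub>G\<^esub> P b t) \<inter> (s <#\<^bsub>G\<^esub> P c s) \<noteq> {}" for b c s t
      using that by blast
    show ?thesis
      unfolding disjoint_family_on_def
    proof (intro ballI impI)
      fix i j :: "bool \<times> 'a" assume "i \<in> UNIV \<times> T" "j \<in> UNIV \<times> T" "i \<noteq> j"
      then show "(case i of (b, t) \<Rightarrow> t <#\<^bsub>G\<^esub> P b t) \<inter> (case j of (b, t) \<Rightarrow> t <#\<^bsub>G\<^esub> P b t) = {}"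
        using *[of "snd i" "snd j" "fst i" "fst j"] by (simp add: case_prod_unfold mem_Times_iff) metis
    qed
  qed
  have "2 = (\<Sum>b\<in>(UNIV :: bool set). \<mu> (\<Union>t\<in>T. P b t))"
    by (simp add: cover one)
  also have "\<dots> = (\<Sum>b\<in>(UNIV :: bool set). \<Sum>t\<in>T. \<mu> (P b t))"
    by (intro sum.cong refl finitely_additive_UN[of "carrier G"] add T PG disj1)
  also have "\<dots> = (\<Sum>(b, t)\<in>UNIV \<times> T. \<mu> (t <#\<^bsub>G\<^esub> P b t))"
  proof -
    have "(\<Sum>b\<in>(UNIV :: bool set). \<Sum>t\<in>T. \<mu> (P b t)) = (\<Sum>b\<in>UNIV. \<Sum>t\<in>T. \<mu> (t <#\<^bsub>G\<^esub> P b t))"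
      using inv[OF _ PG] T by (intro sum.cong refl) (simp add: subset_iff)
    then show ?thesis by (simp only: sum.cartesian_product)
  qed
  also have "\<dots> = \<mu> (\<Union>(b, t)\<in>UNIV \<times> T. t <#\<^bsub>G\<^esub> P b t)"
  proof -
    define Q where "Q = (\<lambda>(b, t). t <#\<^bsub>G\<^esub> P b t)"
    have "Q i \<subseteq> carrier G" if "i \<in> UNIV \<times> T" for i
      using that coset by (simp add: Q_def case_prod_unfold mem_Times_iff)
    then have "\<mu> (\<Union>i\<in>UNIV \<times> T. Q i) = (\<Sum>i\<in>UNIV \<times> T. \<mu> (Q i))"
      using T disj2 by (intro finitely_additive_UN[of "carrier G"] add) (auto simp: Q_def)
    then show ?thesis by (simp add: Q_def case_prod_unfold)
  qed
  also have "\<dots> \<le> \<mu> (carrier G)"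
  proof -
    let ?U = "\<Union>(b, t)\<in>UNIV \<times> T. t <#\<^bsub>G\<^esub> P b t"
    have U: "?U \<subseteq> carrier G"
      using coset by (intro UN_least) (simp add: case_prod_unfold mem_Times_iff)
    then have "\<mu> (?U \<union> (carrier G - ?U)) = \<mu> ?U + \<mu> (carrier G - ?U)"
      by (intro add) auto
    then show ?thesis using pos[of "carrier G - ?U"] U by (simp add: Un_absorb1)
  qed
  finally show False using one by simp
qed

text \<open>
If \<open>S\<close> enlarged every finite set by the factor \<open>1 + \<epsilon>\<close>, a high power of \<open>S\<close> would enlarge it by the
factor \<open>2\<close>.
\<close>

theorem amenable_folner:
  fixes \<epsilon> :: real
  assumes am: "amenable_group G" and S: "finite S" "S \<subseteq> carrier G" and \<epsilon>: "\<epsilon> > 0"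
  shows "\<exists>F. finite F \<and> F \<noteq> {} \<and> F \<subseteq> carrier G \<and>
    real (card (S <#>\<^bsub>G\<^esub> F)) \<le> (1 + \<epsilon>) * real (card F)"
proof (rule ccontr)
  assume *: "\<not> ?thesis"
  have grow: "(1 + \<epsilon>) * real (card F) \<le> real (card (S <#>\<^bsub>G\<^esub> F))"
    if "finite F" "F \<subseteq> carrier G" for F
  proof (cases "F = {}")
    case False
    then have "\<not> real (card (S <#>\<^bsub>G\<^esub> F)) \<le> (1 + \<epsilon>) * real (card F)"
      using * that by blast
    then show ?thesis by simp
  qed simp
  interpret group G by (rule amenable_group_imp_group[OF am])
  define T where "T = rec_nat {\<one>\<^bsub>G\<^esub>} (\<lambda>_ X. S <#>\<^bsub>G\<^esub> X)"
  have T[simp]: "T 0 = {\<one>\<^bsub>G\<^esub>}" "T (Suc n) = S <#>\<^bsub>G\<^esub> T n" for n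
    by (simp_all add: T_def)
  have fin_mult: "finite (A <#>\<^bsub>G\<^esub> B)" if "finite A" "finite B" for A B
    using that by (simp add: set_mult_def)
  have TG: "finite (T n)" "T n \<subseteq> carrier G" for n
    by (induction n) (simp_all add: S fin_mult set_mult_closed)
  have "(1 + \<epsilon>) ^ n * real (card F) \<le> real (card (T n <#>\<^bsub>G\<^esub> F))"
    if F: "finite F" "F \<subseteq> carrier G" for F n
  proof (induction n)
    case 0
    have "{\<one>\<^bsub>G\<^esub>} <#>\<^bsub>G\<^esub> F = F" using F by (force simp: set_mult_def)
    then show ?case by simp
  next
    case (Suc n)
    have "(1 + \<epsilon>) ^ Suc n * real (card F) \<le> (1 + \<epsilon>) * real (card (T n <#>\<^bsub>G\<^esub> F))"
      using Suc \<epsilon> by (simp add: mult.assoc)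
    also have "\<dots> \<le> real (card (S <#>\<^bsub>G\<^esub> (T n <#>\<^bsub>G\<^esub> F)))"
      using F TG by (intro grow fin_mult set_mult_closed)
    also have "S <#>\<^bsub>G\<^esub> (T n <#>\<^bsub>G\<^esub> F) = T (Suc n) <#>\<^bsub>G\<^esub> F"
      using S TG F by (simp add: set_mult_assoc)
    finally show ?case .
  qed
  moreover obtain n where "2 < (1 + \<epsilon>) ^ n"
    using real_arch_pow[of "1 + \<epsilon>" 2] \<epsilon> by auto
  ultimately have "2 * real (card F) \<le> real (card (T n <#>\<^bsub>G\<^esub> F))" if "finite F" "F \<subseteq> carrier G" for F
    using that by (meson less_imp_le mult_right_mono of_nat_0_le_iff order_trans)
  then show False
    using amenable_not_doubling[OF am TG[of n]] by (metis not_le of_nat_le_iff of_nat_mult of_nat_numeral)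
qed

section \<open>Means on bounded functions\<close>

text \<open>
Finitely additive integration, given as a positive normalised functional. Boundedness is required on
the whole type, positivity only on \<open>X\<close>: a mean on the carrier of a group does not see the values of a
function elsewhere (\<open>mean_cong\<close> below).
\<close>

definition mean_on :: "'a set \<Rightarrow> (('a \<Rightarrow> real) \<Rightarrow> real) \<Rightarrow> bool" where
  "mean_on X M \<longleftrightarrow>
     (\<forall>f g. bounded (range f) \<longrightarrow> bounded (range g) \<longrightarrow> M (\<lambda>x. f x + g x) = M f + M g) \<and>
     (\<forall>c f. bounded (range f) \<longrightarrow> M (\<lambda>x. c * f x) = c * M f) \<and>
     (\<forall>f. bounded (range f) \<longrightarrow> (\<forall>x\<in>X. 0 \<le> f x) \<longrightarrow> 0 \<le> M f) \<and>
     M (\<lambda>_. 1) = 1"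

definition left_invariant :: "('a, 'm) monoid_scheme \<Rightarrow> (('a \<Rightarrow> real) \<Rightarrow> real) \<Rightarrow> bool" where
  "left_invariant G M \<longleftrightarrow>
     (\<forall>s\<in>carrier G. \<forall>f. bounded (range f) \<longrightarrow> M (\<lambda>x. f (s \<otimes>\<^bsub>G\<^esub> x)) = M f)"

lemma bounded_rangeI: "(\<And>x. \<bar>f x\<bar> \<le> C) \<Longrightarrow> bounded (range (f :: 'a \<Rightarrow> real))"
  by (auto simp: bounded_iff)

lemma bounded_rangeE:
  assumes "bounded (range (f :: 'a \<Rightarrow> real))"
  obtains C where "C \<ge> 0" "\<And>x. \<bar>f x\<bar> \<le> C"
proof -
  obtain a where a: "\<And>x. \<bar>f x\<bar> \<le> a"
    using assms by (auto simp: bounded_iff)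
  then show ?thesis
    using that[of a] abs_ge_zero[of "f undefined"] order_trans by blast
qed

lemma bounded_range_comp: "bounded (range (f :: 'a \<Rightarrow> real)) \<Longrightarrow> bounded (range (\<lambda>x. f (g x)))"
  by (auto simp: bounded_iff)

lemma bounded_range_mult:
  assumes "bounded (range (f :: 'a \<Rightarrow> real))" "bounded (range g)"
  shows "bounded (range (\<lambda>x. f x * g x))"
proof -
  obtain C where C: "C \<ge> 0" "\<And>x. \<bar>f x\<bar> \<le> C" using bounded_rangeE[OF assms(1)] by blast
  obtain D where D: "D \<ge> 0" "\<And>x. \<bar>g x\<bar> \<le> D" using bounded_rangeE[OF assms(2)] by blast
  show ?thesis
    by (rule bounded_rangeI[of _ "C * D"]) (use C D in \<open>simp add: abs_mult mult_mono\<close>)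
qed

lemma bounded_range_add:
  assumes "bounded (range (f :: 'a \<Rightarrow> real))" "bounded (range g)"
  shows "bounded (range (\<lambda>x. f x + g x))"
proof -
  obtain C where C: "C \<ge> 0" "\<And>x. \<bar>f x\<bar> \<le> C" using bounded_rangeE[OF assms(1)] by blast
  obtain D where D: "D \<ge> 0" "\<And>x. \<bar>g x\<bar> \<le> D" using bounded_rangeE[OF assms(2)] by blast
  show ?thesis
    by (rule bounded_rangeI[of _ "C + D"]) (use C D in \<open>metis abs_triangle_ineq add_mono order_trans\<close>)
qed

lemma bounded_range_const: "bounded (range (\<lambda>x :: 'a. c :: real))"
  by (rule bounded_rangeI[of _ "\<bar>c\<bar>"]) simp

lemma bounded_range_indicator: "bounded (range (indicat_real A))"
  by (rule bounded_rangeI[of _ 1]) (simp add: indicator_def)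

lemma bounded_range_uminus: "bounded (range (f :: 'a \<Rightarrow> real)) \<Longrightarrow> bounded (range (\<lambda>x. - f x))"
  by (auto simp: bounded_iff)

lemma bounded_range_diff:
  "bounded (range (f :: 'a \<Rightarrow> real)) \<Longrightarrow> bounded (range g) \<Longrightarrow> bounded (range (\<lambda>x. f x - g x))"
  using bounded_range_add[OF _ bounded_range_uminus, of f g] by simp

lemma bounded_range_power: "bounded (range (f :: 'a \<Rightarrow> real)) \<Longrightarrow> bounded (range (\<lambda>x. (f x)\<^sup>2))"
  unfolding power2_eq_square by (rule bounded_range_mult)

lemma bounded_range_sum_list:
  assumes "\<And>i. i \<in> set is \<Longrightarrow> bounded (range (\<lambda>x :: 'a. f i x :: real))"
  shows "bounded (range (\<lambda>x. \<Sum>i\<leftarrow>is. f i x))"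
  using assms by (induction "is") (auto intro: bounded_range_add bounded_range_const)

lemmas bounded_range_intros = bounded_range_const bounded_range_indicator bounded_range_mult
  bounded_range_add bounded_range_diff bounded_range_uminus bounded_range_power
  bounded_range_sum_list

context
  fixes X :: "'a set" and M :: "('a \<Rightarrow> real) \<Rightarrow> real"
  assumes M: "mean_on X M"
begin

lemma mean_add: "bounded (range f) \<Longrightarrow> bounded (range g) \<Longrightarrow> M (\<lambda>x. f x + g x) = M f + M g"
  using M by (simp add: mean_on_def)

lemma mean_scale: "bounded (range f) \<Longrightarrow> M (\<lambda>x. c * f x) = c * M f"
  using M by (simp add: mean_on_def)

lemma mean_nonneg: "bounded (range f) \<Longrightarrow> (\<And>x. x \<in> X \<Longrightarrow> 0 \<le> f x) \<Longrightarrow> 0 \<le> M f"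
  using M by (simp add: mean_on_def)

lemma mean_const: "M (\<lambda>_. c) = c"
  using mean_scale[OF bounded_range_const, of c 1] M by (simp add: mean_on_def)

lemma mean_diff: "bounded (range f) \<Longrightarrow> bounded (range g) \<Longrightarrow> M (\<lambda>x. f x - g x) = M f - M g"
  using mean_add[of f "\<lambda>x. - 1 * g x"] mean_scale[of g "- 1"] bounded_range_uminus[of g] by simp

lemma mean_mono:
  "bounded (range f) \<Longrightarrow> bounded (range g) \<Longrightarrow> (\<And>x. x \<in> X \<Longrightarrow> f x \<le> g x) \<Longrightarrow> M f \<le> M g"
  using mean_nonneg[of "\<lambda>x. g x - f x"] mean_diff[of g f] bounded_range_diff[of g f] by simp

lemma mean_cong:
  "bounded (range f) \<Longrightarrow> bounded (range g) \<Longrightarrow> (\<And>x. x \<in> X \<Longrightarrow> f x = g x) \<Longrightarrow> M f = M g"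
  using mean_mono[of f g] mean_mono[of g f] by simp

lemma mean_abs_le:
  assumes "bounded (range f)" "\<And>x. x \<in> X \<Longrightarrow> \<bar>f x\<bar> \<le> c"
  shows "\<bar>M f\<bar> \<le> c"
proof -
  have "f x \<le> c \<and> - c \<le> f x" if "x \<in> X" for x
    using assms(2)[OF that] by (auto simp: abs_le_iff)
  then show ?thesis
    using mean_mono[OF assms(1) bounded_range_const, of c]
      mean_mono[OF bounded_range_const assms(1), of "- c"]
    by (simp add: mean_const abs_le_iff)
qed

lemma mean_close:
  assumes "bounded (range f)" "bounded (range g)" "\<And>x. x \<in> X \<Longrightarrow> \<bar>f x - g x\<bar> \<le> c"
  shows "\<bar>M f - M g\<bar> \<le> c"
  using mean_abs_le[OF bounded_range_diff[OF assms(1,2)] assms(3)] mean_diff[OF assms(1,2)] by simp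

lemma mean_sum_list:
  assumes "\<And>i. i \<in> set is \<Longrightarrow> bounded (range (\<lambda>x. f i x))"
  shows "M (\<lambda>x. \<Sum>i\<leftarrow>is. f i x) = (\<Sum>i\<leftarrow>is. M (f i))"
  using assms
  by (induction "is") (simp_all add: mean_const mean_add bounded_range_sum_list)

text \<open>
The square of \<open>f - t g\<close> has nonnegative mean for \<open>t\<close> the mean of \<open>f g\<close>, which is the best coefficient
when \<open>g\<close> has norm \<open>1\<close> and still good enough when \<open>g\<close> is smaller.
\<close>

lemma mean_Cauchy_Schwarz:
  assumes f: "bounded (range f)" and g: "bounded (range g)"
    and 1: "\<And>x. x \<in> X \<Longrightarrow> \<bar>g x\<bar> \<le> 1"
  shows "(M (\<lambda>x. f x * g x))\<^sup>2 \<le> M (\<lambda>x. (f x)\<^sup>2)"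
proof -
  define t where "t = M (\<lambda>x. f x * g x)"
  have "0 \<le> M (\<lambda>x. (f x - t * g x)\<^sup>2)"
    by (rule mean_nonneg) (auto intro!: bounded_range_intros f g)
  also have "\<dots> = M (\<lambda>x. ((f x)\<^sup>2 - 2 * t * (f x * g x)) + t\<^sup>2 * (g x)\<^sup>2)"
    by (intro arg_cong[where f = M] ext) (simp add: power2_eq_square algebra_simps)
  also have "\<dots> = M (\<lambda>x. (f x)\<^sup>2) - 2 * t * t + t\<^sup>2 * M (\<lambda>x. (g x)\<^sup>2)"
    by (simp only: mean_add mean_diff mean_scale bounded_range_intros f g t_def)
  also have "\<dots> \<le> M (\<lambda>x. (f x)\<^sup>2) - 2 * t * t + t\<^sup>2 * 1"
  proof -
    have "M (\<lambda>x. (g x)\<^sup>2) \<le> M (\<lambda>_. 1)"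
      using 1 by (intro mean_mono bounded_range_intros g) (simp add: abs_square_le_1)
    then show ?thesis by (simp add: mean_const mult_left_le)
  qed
  finally show ?thesis by (simp add: t_def power2_eq_square)
qed

end

section \<open>Invariant means from the density\<close>

lemma sigma_R_witness:
  assumes "group G" and "A \<subseteq> carrier G" and F: "finite F" "F \<noteq> {}" "F \<subseteq> carrier G"
    and c: "c < sigma_R G A"
  shows "\<exists>y\<in>carrier G. c * real (card F) \<le> (\<Sum>f\<in>F. indicat_real A (f \<otimes>\<^bsub>G\<^esub> y))"
proof -
  interpret group G by fact
  let ?q = "\<lambda>F y. real (card (F \<inter> (A #>\<^bsub>G\<^esub> y))) / real (card F)"
  have le1: "?q F y \<le> 1" if "finite F" for F y
    using card_mono[OF that Int_lower1, of "A #>\<^bsub>G\<^esub> y"]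
    by (cases "card F = 0") (auto simp: divide_le_eq_1)
  have bdd: "bdd_above (?q F ` carrier G)" if "finite F" for F
    using le1[OF that] by (intro bdd_aboveI[of _ 1]) auto
  have "sigma_R G A \<le> (SUP y\<in>carrier G. ?q F y)"
    unfolding sigma_R_def
  proof (rule cINF_lower)
    show "bdd_below ((\<lambda>F. SUP y\<in>carrier G. ?q F y) ` {F. finite F \<and> F \<noteq> {} \<and> F \<subseteq> carrier G})"
    proof (rule bdd_belowI[of _ 0], clarify)
      fix F :: "'a set" assume F: "finite F"
      show "0 \<le> (SUP y\<in>carrier G. ?q F y)"
        by (rule cSUP_upper2[OF bdd[OF F] one_closed]) simp
    qed
  qed (use F in auto)
  then obtain y where y: "y \<in> carrier G" "c < ?q F y"
    using c less_cSUP_iff[OF _ bdd[OF F(1)], of c] by fastforce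
  have *: "F \<inter> (A #>\<^bsub>G\<^esub> y) = {f\<in>F. f \<otimes>\<^bsub>G\<^esub> inv\<^bsub>G\<^esub> y \<in> A}"
  proof -
    have "f \<in> A #>\<^bsub>G\<^esub> y \<longleftrightarrow> f \<otimes>\<^bsub>G\<^esub> inv\<^bsub>G\<^esub> y \<in> A" if f: "f \<in> F" for f
    proof -
      have "f \<in> carrier G" using f F by auto
      then have "\<exists>a\<in>A. f = a \<otimes>\<^bsub>G\<^esub> y" if "f \<otimes>\<^bsub>G\<^esub> inv\<^bsub>G\<^esub> y \<in> A"
        using that y(1) by (intro bexI[of _ "f \<otimes>\<^bsub>G\<^esub> inv\<^bsub>G\<^esub> y"]) (simp_all add: m_assoc)
      moreover have "(a \<otimes>\<^bsub>G\<^esub> y) \<otimes>\<^bsub>G\<^esub> inv\<^bsub>G\<^esub> y = a" if "a \<in> A" for a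
        using that y(1) \<open>A \<subseteq> carrier G\<close> by (simp add: m_assoc subset_iff)
      ultimately show ?thesis
        unfolding r_coset_def by auto
    qed
    then show ?thesis by blast
  qed
  have "(\<Sum>f\<in>F. indicat_real A (f \<otimes>\<^bsub>G\<^esub> inv\<^bsub>G\<^esub> y)) = real (card {f\<in>F. f \<otimes>\<^bsub>G\<^esub> inv\<^bsub>G\<^esub> y \<in> A})"
  proof -
    have "{f\<in>F. f \<otimes>\<^bsub>G\<^esub> inv\<^bsub>G\<^esub> y \<in> A} = F \<inter> {f. f \<otimes>\<^bsub>G\<^esub> inv\<^bsub>G\<^esub> y \<in> A}" by auto
    then show ?thesis using F by (simp add: indicator_def sum_of_bool_eq)
  qed
  moreover have "c * real (card F) \<le> real (card (F \<inter> (A #>\<^bsub>G\<^esub> y)))"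
    using y(2) F card_gt_0_iff[of F] by (simp add: pos_less_divide_eq less_imp_le)
  ultimately show ?thesis
    using * inv_closed[OF y(1)] by (intro bexI[of _ "inv\<^bsub>G\<^esub> y"]) simp_all
qed

lemma continuous_on_evaluation: "continuous_on UNIV (\<lambda>m :: 'b \<Rightarrow> real. m a)"
  by (rule continuous_on_product_coordinates)

lemma compact_function_box:
  fixes C :: "'b \<Rightarrow> real"
  shows "compact {m :: 'b \<Rightarrow> real. \<forall>a. \<bar>m a\<bar> \<le> C a}"
proof -
  have "compactin (product_topology (\<lambda>_. euclidean) UNIV) (\<Pi>\<^sub>E a\<in>UNIV. {- C a..C a})"
    by (simp add: compactin_PiE)
  moreover have "(\<Pi>\<^sub>E a\<in>UNIV. {- C a..C a}) = {m. \<forall>a. \<bar>m a\<bar> \<le> C a}"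
    by (auto simp: PiE_iff abs_le_iff minus_le_iff)
  ultimately show ?thesis
    by (simp add: euclidean_product_topology)
qed

lemma closed_mean_on: "closed {M. mean_on X M}"
  unfolding mean_on_def
  by (intro closed_Collect_conj closed_Collect_all closed_Collect_imp closed_Collect_eq
      closed_Collect_le open_Collect_const continuous_intros continuous_on_evaluation)

lemma abs_sum_diff_le:
  fixes b :: "'a \<Rightarrow> real"
  assumes "finite X" "finite Y" and b: "\<And>x. \<bar>b x\<bar> \<le> C"
  shows "\<bar>sum b X - sum b Y\<bar> \<le> C * real (card (X - Y) + card (Y - X))"
proof -
  have "sum b X - sum b Y = sum b (X - Y) - sum b (Y - X)"
    using assms(1,2) sum.Int_Diff[of X b Y] sum.Int_Diff[of Y b X] by (simp add: Int_commute)
  also have "\<bar>\<dots>\<bar> \<le> \<bar>sum b (X - Y)\<bar> + \<bar>sum b (Y - X)\<bar>" by simp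
  also have "\<dots> \<le> real (card (X - Y)) * C + real (card (Y - X)) * C"
    using sum_norm_bound[of "X - Y" b C] sum_norm_bound[of "Y - X" b C] b by (intro add_mono) auto
  finally show ?thesis by (simp add: algebra_simps)
qed

text \<open>
The functionals bounded by the supremum norm form a compact space under pointwise convergence. In it,
being a mean, being invariant under \<open>S\<close> up to \<open>\<epsilon>\<close>, and giving \<open>A\<close> at least \<open>c\<close> are closed conditions,
satisfied by the average over a Folner set translated so that it meets \<open>A\<close> in a large proportion. The
finite intersection property provides a functional that satisfies them for all \<open>S\<close> and \<open>\<epsilon>\<close>.
\<close>

theorem sigma_R_pos_imp_invariant_mean:
  fixes G :: "('a, 'm) monoid_scheme"
  assumes am: "amenable_group G" and A: "A \<subseteq> carrier G" and pos: "sigma_R G A > 0"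
  shows "\<exists>M. mean_on (carrier G) M \<and> left_invariant G M \<and> M (indicat_real A) > 0"
proof -
  interpret group G by (rule amenable_group_imp_group[OF am])
  \<comment> \<open>The value 0 for unbounded functions confines all functionals to one compact box.\<close>
  define C where "C a = (if bounded (range a) then SUP x. \<bar>a x\<bar> else 0)" for a :: "'a \<Rightarrow> real"
  have C: "\<bar>a x\<bar> \<le> C a" if a: "bounded (range a)" for a x
  proof -
    obtain c where "\<And>x. \<bar>a x\<bar> \<le> c" using bounded_rangeE[OF a] by blast
    then have "bdd_above (range (\<lambda>x. \<bar>a x\<bar>))" by (intro bdd_aboveI[of _ c]) auto
    then show ?thesis using a cSUP_upper[of x UNIV "\<lambda>x. \<bar>a x\<bar>"] by (simp add: C_def)
  qed
  define c where "c = sigma_R G A / 2"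
  have c: "0 < c" "c < sigma_R G A" using pos by (simp_all add: c_def)
  define Z where "Z = (\<lambda>(S, \<epsilon>). {M. mean_on (carrier G) M \<and>
      (\<forall>s. s \<in> S \<longrightarrow> (\<forall>a. bounded (range a) \<longrightarrow> \<bar>M (\<lambda>x. a (s \<otimes>\<^bsub>G\<^esub> x)) - M a\<bar> \<le> 2 * \<epsilon> * C a)) \<and>
      c \<le> M (indicat_real A)})"
  define I where "I = {(S, \<epsilon> :: real). finite S \<and> S \<subseteq> carrier G \<and> \<epsilon> > 0}"
  let ?B = "{M. \<forall>a. \<bar>M a\<bar> \<le> C a}"
  have nonempty: "?B \<inter> Z (S, \<epsilon>) \<noteq> {}" if I: "(S, \<epsilon>) \<in> I" for S \<epsilon>
  proof -
    have S: "finite S" "S \<subseteq> carrier G" and \<epsilon>: "\<epsilon> > 0" using I by (auto simp: I_def)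
    \<comment> \<open>With the unit in the set, its product with F contains F and all the translates.\<close>
    let ?S = "insert \<one>\<^bsub>G\<^esub> S"
    obtain F where F: "finite F" "F \<noteq> {}" "F \<subseteq> carrier G"
      and folner: "real (card (?S <#>\<^bsub>G\<^esub> F)) \<le> (1 + \<epsilon>) * real (card F)"
      using amenable_folner[OF am, of ?S \<epsilon>] S \<epsilon> by auto
    have F0: "real (card F) > 0" using F by (simp add: card_gt_0_iff)
    obtain y where y: "y \<in> carrier G" "c * real (card F) \<le> (\<Sum>f\<in>F. indicat_real A (f \<otimes>\<^bsub>G\<^esub> y))"
      using sigma_R_witness[OF is_group A F c(2)] by blast
    define M where "M a = (if bounded (range a) then (\<Sum>f\<in>F. a (f \<otimes>\<^bsub>G\<^esub> y)) / real (card F) else 0)"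
      for a :: "'a \<Rightarrow> real"
    have "\<bar>M a\<bar> \<le> C a" for a
    proof (cases "bounded (range a)")
      case True
      have "\<bar>\<Sum>f\<in>F. a (f \<otimes>\<^bsub>G\<^esub> y)\<bar> \<le> real (card F) * C a"
        using sum_norm_bound[of F "\<lambda>f. a (f \<otimes>\<^bsub>G\<^esub> y)" "C a"] C[OF True] by simp
      then show ?thesis using True F0 by (simp add: M_def divide_le_eq mult.commute)
    qed (simp add: M_def C_def)
    moreover have "mean_on (carrier G) M"
      unfolding mean_on_def using F F0 y(1)
      by (auto simp: M_def bounded_range_intros sum.distrib add_divide_distrib sum_distrib_left[symmetric]
          subset_iff intro!: divide_nonneg_pos sum_nonneg)
    moreover have "\<bar>M (\<lambda>x. a (s \<otimes>\<^bsub>G\<^esub> x)) - M a\<bar> \<le> 2 * \<epsilon> * C a" if s: "s \<in> S" and a: "bounded (range a)" for s a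
    proof -
      define b where "b x = a (x \<otimes>\<^bsub>G\<^esub> y)" for x
      let ?sF = "(\<lambda>f. s \<otimes>\<^bsub>G\<^esub> f) ` F"
      have sG: "s \<in> carrier G" using s S by auto
      have inj: "inj_on (\<lambda>f. s \<otimes>\<^bsub>G\<^esub> f) F"
        using inj_on_cmult[OF sG] F(3) by (rule inj_on_subset)
      have "F \<union> ?sF \<subseteq> ?S <#>\<^bsub>G\<^esub> F"
        using F(3) s by (fastforce simp: set_mult_def)
      then have "card (F \<union> ?sF) \<le> card (?S <#>\<^bsub>G\<^esub> F)"
        using F(1) S(1) by (intro card_mono) (auto simp: set_mult_def)
      moreover have "card (F \<union> ?sF) = card F + card (?sF - F)"
        using F(1) by (subst card_Un_disjoint[symmetric]) (auto intro!: arg_cong[where f = card])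
      ultimately have 1: "real (card (?sF - F)) \<le> \<epsilon> * real (card F)"
        using folner by (simp add: algebra_simps)
      \<comment> \<open>F and its translate have the same number of elements.\<close>
      have "card (F - ?sF) = card (?sF - F)"
        using card_image[OF inj] F(1) card_le_sym_Diff[of F ?sF] card_le_sym_Diff[of ?sF F] by simp
      then have "C a * real (card (?sF - F) + card (F - ?sF)) \<le> C a * (2 * (\<epsilon> * real (card F)))"
        using 1 C[OF a, of undefined] by (intro mult_left_mono) auto
      moreover have "\<bar>sum b ?sF - sum b F\<bar> \<le> C a * real (card (?sF - F) + card (F - ?sF))"
        using F(1) C[OF a] by (intro abs_sum_diff_le) (auto simp: b_def)
      moreover have "sum b ?sF = (\<Sum>f\<in>F. a (s \<otimes>\<^bsub>G\<^esub> (f \<otimes>\<^bsub>G\<^esub> y)))"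
        using sum.reindex[OF inj, of b] F(3) y(1) sG by (auto simp: b_def m_assoc subset_iff intro!: sum.cong)
      ultimately have "\<bar>(\<Sum>f\<in>F. a (s \<otimes>\<^bsub>G\<^esub> (f \<otimes>\<^bsub>G\<^esub> y))) - (\<Sum>f\<in>F. a (f \<otimes>\<^bsub>G\<^esub> y))\<bar> \<le> 2 * \<epsilon> * C a * real (card F)"
        by (simp add: b_def algebra_simps)
      moreover have "M (\<lambda>x. a (s \<otimes>\<^bsub>G\<^esub> x)) - M a
          = ((\<Sum>f\<in>F. a (s \<otimes>\<^bsub>G\<^esub> (f \<otimes>\<^bsub>G\<^esub> y))) - (\<Sum>f\<in>F. a (f \<otimes>\<^bsub>G\<^esub> y))) / real (card F)"
        using a bounded_range_comp[OF a, of "\<lambda>x. s \<otimes>\<^bsub>G\<^esub> x"] by (simp add: M_def diff_divide_distrib)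
      ultimately show ?thesis using F0 by (simp add: divide_le_eq)
    qed
    moreover have "c \<le> M (indicat_real A)"
      using y(2) F0 by (simp add: M_def bounded_range_indicator le_divide_eq)
    ultimately have "M \<in> ?B \<inter> Z (S, \<epsilon>)" by (simp add: Z_def)
    then show ?thesis by blast
  qed
  have "?B \<inter> (\<Inter>i\<in>I. Z i) \<noteq> {}"
  proof (rule compact_imp_fip_image)
    show "compact ?B" by (rule compact_function_box)
    show "closed (Z i)" for i
      unfolding Z_def case_prod_unfold
      by (intro closed_Collect_conj closed_Collect_all closed_Collect_imp closed_Collect_le
          open_Collect_const closed_mean_on continuous_intros continuous_on_evaluation)
    fix J assume J: "finite J" "J \<subseteq> I"
    define S where "S = \<Union> (fst ` J)"
    define \<epsilon> where "\<epsilon> = Min (insert 1 (snd ` J))"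
    have J': "finite (fst i) \<and> fst i \<subseteq> carrier G \<and> snd i > 0" if "i \<in> J" for i
      using subsetD[OF J(2) that] by (simp add: I_def case_prod_unfold)
    have "finite S" "S \<subseteq> carrier G"
      unfolding S_def using J(1) J' by auto
    moreover have "\<epsilon> > 0"
      unfolding \<epsilon>_def using J(1) J' by (subst Min_gr_iff) auto
    ultimately have "(S, \<epsilon>) \<in> I" by (simp add: I_def)
    then obtain M where M: "M \<in> ?B" "M \<in> Z (S, \<epsilon>)" using nonempty by blast
    have "M \<in> Z i" if i: "i \<in> J" for i
    proof -
      have 1: "\<epsilon> \<le> snd i" "fst i \<subseteq> S" using J i by (auto simp: \<epsilon>_def S_def)
      have "\<bar>M (\<lambda>x. a (s \<otimes>\<^bsub>G\<^esub> x)) - M a\<bar> \<le> 2 * snd i * C a"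
        if "s \<in> fst i" "bounded (range a)" for s a
      proof -
        have "\<bar>M (\<lambda>x. a (s \<otimes>\<^bsub>G\<^esub> x)) - M a\<bar> \<le> 2 * \<epsilon> * C a"
          using M(2) 1 that by (auto simp: Z_def)
        also have "\<dots> \<le> 2 * snd i * C a"
          using 1 C[OF that(2), of undefined] by (intro mult_right_mono) auto
        finally show ?thesis .
      qed
      then show ?thesis using M(2) by (auto simp: Z_def case_prod_unfold)
    qed
    then show "?B \<inter> (\<Inter>i\<in>J. Z i) \<noteq> {}" using M(1) by blast
  qed
  then obtain M where M: "\<And>i. i \<in> I \<Longrightarrow> M \<in> Z i" by blast
  have "({}, 1) \<in> I" by (simp add: I_def)
  from M[OF this] have "mean_on (carrier G) M" "c \<le> M (indicat_real A)" by (auto simp: Z_def)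
  moreover have "M (\<lambda>x. a (s \<otimes>\<^bsub>G\<^esub> x)) = M a" if s: "s \<in> carrier G" and a: "bounded (range a)" for s a
  proof -
    have "\<bar>M (\<lambda>x. a (s \<otimes>\<^bsub>G\<^esub> x)) - M a\<bar> \<le> 0 + e" if e: "e > 0" for e
    proof -
      define \<epsilon> where "\<epsilon> = e / (2 * (C a + 1))"
      have C0: "C a \<ge> 0" using C[OF a, of undefined] by simp
      have "\<epsilon> > 0" using C0 e by (simp add: \<epsilon>_def)
      then have "M \<in> Z ({s}, \<epsilon>)" using s by (intro M) (simp add: I_def)
      then have "\<bar>M (\<lambda>x. a (s \<otimes>\<^bsub>G\<^esub> x)) - M a\<bar> \<le> 2 * \<epsilon> * C a" using a by (simp add: Z_def)
      also have "\<dots> \<le> e" using C0 e by (simp add: \<epsilon>_def field_simps)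
      finally show ?thesis by simp
    qed
    then have "\<bar>M (\<lambda>x. a (s \<otimes>\<^bsub>G\<^esub> x)) - M a\<bar> \<le> 0" by (rule field_le_epsilon)
    then show ?thesis by simp
  qed
  then have "left_invariant G M" by (simp add: left_invariant_def)
  ultimately show ?thesis using c(1) by (intro exI[of _ M]) simp
qed

section \<open>Convex combinations of almost minimal norm\<close>

text \<open>
The iterated mean replaces a product measure. The two means need not commute, but positivity and
linearity suffice for a semi-inner product on functions of two variables.
\<close>

lemma mean_on_prod:
  assumes M: "mean_on X M" and N: "mean_on Y N"
  shows "mean_on (X \<times> Y) (\<lambda>f. M (\<lambda>x. N (\<lambda>y. f (x, y))))"
proof -
  have fibre: "bounded (range (\<lambda>y. f (x, y)))" if "bounded (range f)" for f :: "'a \<times> 'b \<Rightarrow> real" and x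
    using that by (rule bounded_range_comp)
  have inner: "bounded (range (\<lambda>x. N (\<lambda>y. f (x, y))))" if f: "bounded (range f)" for f :: "'a \<times> 'b \<Rightarrow> real"
  proof -
    obtain C where "\<And>z. \<bar>f z\<bar> \<le> C" using bounded_rangeE[OF f] by blast
    then show ?thesis
      by (intro bounded_rangeI[of _ C] mean_abs_le[OF N fibre[OF f]])
  qed
  show ?thesis
    unfolding mean_on_def
    by (auto simp: mean_add[OF N] mean_scale[OF N] mean_const[OF N] mean_add[OF M] mean_scale[OF M]
        mean_const[OF M] fibre inner intro!: mean_nonneg[OF M] mean_nonneg[OF N])
qed

text \<open>
Lists serve as convex combinations with rational weights, repetitions giving the weights. The midpoint
of the averages over two lists of equal length is the average over their concatenation.
\<close>

definition average :: "('x \<Rightarrow> real) \<Rightarrow> 'x list \<Rightarrow> real" where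
  "average f xs = (\<Sum>x\<leftarrow>xs. f x) / real (length xs)"

lemma average_const: "xs \<noteq> [] \<Longrightarrow> average (\<lambda>_. c) xs = c"
  by (simp add: average_def sum_list_triv)

lemma average_mono: "(\<And>x. x \<in> set xs \<Longrightarrow> f x \<le> g x) \<Longrightarrow> average f xs \<le> average g xs"
  unfolding average_def by (intro divide_right_mono sum_list_mono) auto

lemma average_cong: "(\<And>x. x \<in> set xs \<Longrightarrow> f x = g x) \<Longrightarrow> average f xs = average g xs"
  unfolding average_def by (metis map_eq_conv)

lemma average_le: "xs \<noteq> [] \<Longrightarrow> (\<And>x. x \<in> set xs \<Longrightarrow> f x \<le> c) \<Longrightarrow> average f xs \<le> c"
  using average_mono[of xs f "\<lambda>_. c"] by (simp add: average_const)

lemma le_average: "xs \<noteq> [] \<Longrightarrow> (\<And>x. x \<in> set xs \<Longrightarrow> c \<le> f x) \<Longrightarrow> c \<le> average f xs"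
  using average_mono[of xs "\<lambda>_. c" f] by (simp add: average_const)

lemma ex_ge_average:
  assumes "xs \<noteq> []"
  shows "\<exists>x\<in>set xs. average f xs \<le> f x"
proof -
  have "Max (f ` set xs) \<in> f ` set xs" using assms by (intro Max_in) auto
  moreover have "average f xs \<le> Max (f ` set xs)" using assms by (intro average_le) auto
  ultimately show ?thesis by auto
qed

lemma average_diff: "average (\<lambda>x. f x - g x) xs = average f xs - average g xs"
  by (simp add: average_def sum_list_subtractf diff_divide_distrib)

lemma abs_average_le: "xs \<noteq> [] \<Longrightarrow> (\<And>x. x \<in> set xs \<Longrightarrow> \<bar>f x\<bar> \<le> c) \<Longrightarrow> \<bar>average f xs\<bar> \<le> c"
  using average_le[of xs f c] le_average[of xs "- c" f] by (fastforce simp: abs_le_iff)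

lemma average_mult: "average (\<lambda>x. f x * c) xs = average f xs * c"
  by (simp add: average_def sum_list_mult_const)

lemma average_append:
  "length ys = length xs \<Longrightarrow> average f (xs @ ys) = (average f xs + average f ys) / 2"
  by (simp add: average_def add_divide_distrib)

lemma average_map: "average f (map g xs) = average (\<lambda>x. f (g x)) xs"
  by (simp add: average_def comp_def)

lemma bounded_range_average:
  "(\<And>x. x \<in> set xs \<Longrightarrow> bounded (range (\<lambda>y :: 'a. f x y :: real))) \<Longrightarrow> bounded (range (\<lambda>y. average (\<lambda>x. f x y) xs))"
  unfolding average_def divide_inverse by (intro bounded_range_intros)

lemma mean_average:
  assumes M: "mean_on X M" and f: "\<And>x. x \<in> set xs \<Longrightarrow> bounded (range (\<lambda>y. f x y))"
  shows "M (\<lambda>y. average (\<lambda>x. f x y) xs) = average (\<lambda>x. M (f x)) xs"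
  using mean_scale[OF M bounded_range_sum_list, of xs "\<lambda>y x. f y x" "inverse (real (length xs))"]
    mean_sum_list[OF M, of xs f] f
  by (simp add: average_def divide_inverse mult.commute)

text \<open>
The geometric core of the mean ergodic theorem. If the average over \<open>xs\<close> has nearly least norm among
all averages and the one over \<open>ys\<close> has the same norm, the parallelogram law and the fact that their
midpoint is again an average make the two nearly equal. For an isometry that permutes the vectors, \<open>ys\<close> is the image of \<open>xs\<close>.
\<close>

lemma near_minimal_average:
  assumes P: "mean_on Y P" and u: "\<And>x. bounded (range (u x))" and "X \<noteq> {}" and \<epsilon>: "\<epsilon> > 0"
  defines "v \<equiv> \<lambda>xs y. average (\<lambda>x. u x y) xs"
  shows "\<exists>xs. xs \<noteq> [] \<and> set xs \<subseteq> X \<and>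
    (\<forall>ys t. set ys \<subseteq> X \<longrightarrow> length ys = length xs \<longrightarrow> P (\<lambda>y. (v ys y)\<^sup>2) = P (\<lambda>y. (v xs y)\<^sup>2) \<longrightarrow>
       (\<forall>y. \<bar>t y\<bar> \<le> 1) \<longrightarrow> \<bar>P (\<lambda>y. v xs y * t y) - P (\<lambda>y. v ys y * t y)\<bar> \<le> \<epsilon>)"
proof -
  have v: "bounded (range (v xs))" for xs
    unfolding v_def by (intro bounded_range_average u)
  define L where "L = {xs. xs \<noteq> [] \<and> set xs \<subseteq> X}"
  define e where "e xs = P (\<lambda>y. (v xs y)\<^sup>2)" for xs
  have "e xs \<ge> 0" for xs
    unfolding e_def by (intro mean_nonneg[OF P] bounded_range_intros v) simp
  then have bdd: "bdd_below (e ` L)" by (intro bdd_belowI[of _ 0]) auto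
  obtain x where "x \<in> X" using \<open>X \<noteq> {}\<close> by blast
  then have "L \<noteq> {}" by (auto simp: L_def intro: exI[of _ "[x]"])
  then obtain xs where xs: "xs \<in> L" "e xs < Inf (e ` L) + \<epsilon>\<^sup>2 / 4"
    using cINF_less_iff[OF _ bdd, of "Inf (e ` L) + \<epsilon>\<^sup>2 / 4"] \<epsilon> by auto
  have "\<bar>P (\<lambda>y. v xs y * t y) - P (\<lambda>y. v ys y * t y)\<bar> \<le> \<epsilon>"
    if ys: "set ys \<subseteq> X" "length ys = length xs" "e ys = e xs" and t: "\<forall>y. \<bar>t y\<bar> \<le> 1" for ys t
  proof -
    have tb: "bounded (range t)" using t by (intro bounded_rangeI[of _ 1]) simp
    have "xs @ ys \<in> L" using xs ys by (simp add: L_def)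
    then have "Inf (e ` L) \<le> e (xs @ ys)" by (intro cINF_lower bdd)
    moreover have "P (\<lambda>y. (v xs y - v ys y)\<^sup>2) + 4 * e (xs @ ys) = 2 * e xs + 2 * e ys"
    proof -
      have "P (\<lambda>y. (v xs y - v ys y)\<^sup>2) + 4 * e (xs @ ys)
          = P (\<lambda>y. (v xs y - v ys y)\<^sup>2 + 4 * (v (xs @ ys) y)\<^sup>2)"
        by (simp only: e_def mean_add[OF P] mean_scale[OF P] bounded_range_intros v)
      also have "\<dots> = P (\<lambda>y. 2 * (v xs y)\<^sup>2 + 2 * (v ys y)\<^sup>2)"
        by (intro arg_cong[where f = P] ext)
          (simp add: v_def average_append[OF ys(2)] power2_eq_square field_simps)
      also have "\<dots> = 2 * e xs + 2 * e ys"
        by (simp only: e_def mean_add[OF P] mean_scale[OF P] bounded_range_intros v)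
      finally show ?thesis .
    qed
    moreover have "(P (\<lambda>y. (v xs y - v ys y) * t y))\<^sup>2 \<le> P (\<lambda>y. (v xs y - v ys y)\<^sup>2)"
      using t by (intro mean_Cauchy_Schwarz[OF P] bounded_range_intros v tb) auto
    ultimately have "(P (\<lambda>y. (v xs y - v ys y) * t y))\<^sup>2 \<le> \<epsilon>\<^sup>2"
      using xs(2) ys(3) by linarith
    moreover have "P (\<lambda>y. (v xs y - v ys y) * t y) = P (\<lambda>y. v xs y * t y) - P (\<lambda>y. v ys y * t y)"
      by (simp only: left_diff_distrib mean_diff[OF P] bounded_range_intros v tb)
    ultimately show ?thesis
      using \<epsilon> abs_le_square_iff[of "P (\<lambda>y. v xs y * t y) - P (\<lambda>y. v ys y * t y)" \<epsilon>] by simp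
  qed
  then show ?thesis using xs(1) unfolding L_def e_def by blast
qed

section \<open>The correlation function of a set\<close>

text \<open>
The positive definite function \<open>g \<mapsto> \<mu>(A \<inter> gA)\<close>, the matrix coefficient of the indicator of \<open>A\<close> under
left translation.
\<close>

definition correlation :: "('a, 'm) monoid_scheme \<Rightarrow> (('a \<Rightarrow> real) \<Rightarrow> real) \<Rightarrow> 'a set \<Rightarrow> 'a \<Rightarrow> real" where
  "correlation G M A g = M (\<lambda>y. indicat_real A y * indicat_real A (inv\<^bsub>G\<^esub> g \<otimes>\<^bsub>G\<^esub> y))"

locale invariant_mean = group G for G (structure) +
  fixes M :: "('a \<Rightarrow> real) \<Rightarrow> real"
  assumes mean: "mean_on (carrier G) M" and invariant: "left_invariant G M"
begin

lemma translate: "s \<in> carrier G \<Longrightarrow> bounded (range f) \<Longrightarrow> M (\<lambda>x. f (s \<otimes> x)) = M f"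
  using invariant by (simp add: left_invariant_def)

lemma bounded_range_indicator_comp: "bounded (range (\<lambda>x. indicat_real A (f x)))"
  by (rule bounded_range_comp[OF bounded_range_indicator])

lemmas bounded_intros = bounded_range_intros bounded_range_indicator_comp bounded_range_average

lemma correlation_bounds: "0 \<le> correlation G M A g" "correlation G M A g \<le> 1"
proof -
  let ?f = "\<lambda>y. indicat_real A y * indicat_real A (inv g \<otimes> y)"
  have f: "bounded (range ?f)" by (intro bounded_intros)
  have "0 \<le> M ?f" by (intro mean_nonneg[OF mean f]) simp
  moreover have "M ?f \<le> M (\<lambda>_. 1)"
    by (intro mean_mono[OF mean f bounded_range_const]) (simp add: indicator_def)
  ultimately show "0 \<le> correlation G M A g" "correlation G M A g \<le> 1"
    by (simp_all add: correlation_def mean_const[OF mean])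
qed

lemma correlation_eq:
  assumes "x \<in> carrier G" "a \<in> carrier G"
  shows "M (\<lambda>y. indicat_real A (x \<otimes> y) * indicat_real A (inv a \<otimes> y)) = correlation G M A (x \<otimes> a)"
proof -
  have "correlation G M A (x \<otimes> a)
      = M (\<lambda>y. indicat_real A (x \<otimes> y) * indicat_real A (inv (x \<otimes> a) \<otimes> (x \<otimes> y)))"
    unfolding correlation_def using assms
    by (intro translate[symmetric, of x "\<lambda>y. indicat_real A y * indicat_real A (inv (x \<otimes> a) \<otimes> y)"] bounded_intros)
  also have "\<dots> = M (\<lambda>y. indicat_real A (x \<otimes> y) * indicat_real A (inv a \<otimes> y))"
  proof (rule mean_cong[OF mean])
    fix y assume y: "y \<in> carrier G"
    have "inv (x \<otimes> a) \<otimes> (x \<otimes> y) = inv a \<otimes> (inv x \<otimes> (x \<otimes> y))"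
      using assms y by (simp add: inv_mult_group m_assoc)
    also have "\<dots> = inv a \<otimes> y" using assms y by (simp add: m_assoc[symmetric])
    finally show "indicat_real A (x \<otimes> y) * indicat_real A (inv (x \<otimes> a) \<otimes> (x \<otimes> y)) =
        indicat_real A (x \<otimes> y) * indicat_real A (inv a \<otimes> y)" by simp
  qed (intro bounded_intros)+
  finally show ?thesis ..
qed

lemma correlation_inv:
  assumes g: "g \<in> carrier G"
  shows "correlation G M A (inv g) = correlation G M A g"
proof -
  have "correlation G M A (inv g) = M (\<lambda>y. indicat_real A (inv g \<otimes> y) * indicat_real A (inv \<one> \<otimes> y))"
    using correlation_eq[of "inv g" \<one>] g by simp
  also have "\<dots> = correlation G M A g"
    unfolding correlation_def
    by (rule mean_cong[OF mean]) (auto intro!: bounded_intros)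
  finally show ?thesis .
qed

definition pair_mean :: "('a \<times> 'a \<Rightarrow> real) \<Rightarrow> real" where
  "pair_mean f = M (\<lambda>y. M (\<lambda>z. f (y, z)))"

lemma mean_on_pair_mean: "mean_on (carrier G \<times> carrier G) pair_mean"
  unfolding pair_mean_def by (rule mean_on_prod[OF mean mean])

lemma pair_mean_translate:
  assumes l: "l \<in> carrier G" and f: "bounded (range f)"
  shows "pair_mean (\<lambda>(y, z). f (l \<otimes> y, l \<otimes> z)) = pair_mean f"
proof -
  obtain C where C: "\<And>p. \<bar>f p\<bar> \<le> C" using bounded_rangeE[OF f] by blast
  have "pair_mean (\<lambda>(y, z). f (l \<otimes> y, l \<otimes> z)) = M (\<lambda>y. M (\<lambda>z. f (l \<otimes> y, z)))"
  proof -
    have "M (\<lambda>z. f (l \<otimes> y, l \<otimes> z)) = M (\<lambda>z. f (l \<otimes> y, z))" for y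
      by (rule translate[OF l, of "\<lambda>z. f (l \<otimes> y, z)"]) (rule bounded_range_comp[OF f])
    then show ?thesis by (simp add: pair_mean_def)
  qed
  also have "\<dots> = pair_mean f"
    unfolding pair_mean_def
    by (rule translate[OF l, of "\<lambda>y. M (\<lambda>z. f (y, z))"])
      (intro bounded_rangeI[of _ C] mean_abs_le[OF mean] bounded_range_comp[OF f] C)
  finally show ?thesis .
qed

lemma pair_mean_times:
  assumes f: "bounded (range f)" and g: "bounded (range g)"
  shows "pair_mean (\<lambda>(y, z). f y * g z) = M f * M g"
  by (simp add: pair_mean_def mean_scale[OF mean g] mean_scale[OF mean f] mult.commute[of _ "M g"])

text \<open>
The vectors \<open>(y, z) \<mapsto> 1\<^sub>A(xy) 1\<^sub>A(xz)\<close> have inner product \<open>\<phi>(xa) \<phi>(xb)\<close> with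
\<open>(y, z) \<mapsto> 1\<^sub>A(a\<inverse>y) 1\<^sub>A(b\<inverse>z)\<close>, and diagonal left translation by \<open>l\<close> turns the average over \<open>xs\<close> into
the average over \<open>xs\<close> multiplied by \<open>l\<close> from the right without changing its norm. An average of nearly
least norm is thus almost unaffected by \<open>l\<close>. The last clause records that such an average \<open>v\<close> is not
small: its squared norm is at least the square of its mean, \<open>\<mu>(A)^4\<close>, and is itself an average of
the products of \<open>v\<close> with the vectors for \<open>a = b = y\<inverse>\<close>, \<open>y \<in> xs\<close>.
\<close>

lemma translation_stable_average:
  fixes A :: "'a set"
  assumes \<epsilon>: "\<epsilon> > 0"
  defines "\<phi> \<equiv> correlation G M A"
  shows "\<exists>xs. xs \<noteq> [] \<and> set xs \<subseteq> carrier G \<and>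
    (\<forall>l\<in>carrier G. \<forall>a\<in>carrier G. \<forall>b\<in>carrier G.
       \<bar>average (\<lambda>x. \<phi> (x \<otimes> a) * \<phi> (x \<otimes> b)) xs - average (\<lambda>x. \<phi> (x \<otimes> l \<otimes> a) * \<phi> (x \<otimes> l \<otimes> b)) xs\<bar> \<le> \<epsilon>) \<and>
    (\<exists>a\<in>carrier G. M (indicat_real A) ^ 4 \<le> average (\<lambda>x. \<phi> (x \<otimes> a) * \<phi> (x \<otimes> a)) xs)"
proof -
  define u where "u x = (\<lambda>(y, z). indicat_real A (x \<otimes> y) * indicat_real A (x \<otimes> z))" for x
  define v where "v xs p = average (\<lambda>x. u x p) xs" for xs p
  define t where "t a b = (\<lambda>(y, z). indicat_real A (inv a \<otimes> y) * indicat_real A (inv b \<otimes> z))" for a b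
  have ub: "bounded (range (u x))" for x
    by (rule bounded_rangeI[of _ 1]) (auto simp: u_def indicator_def)
  have t1: "\<bar>t a b p\<bar> \<le> 1" for a b p
    by (auto simp: t_def indicator_def split: prod.split)
  have tb: "bounded (range (t a b))" for a b
    by (rule bounded_rangeI[of _ 1]) (rule t1)
  have vb: "bounded (range (v xs))" for xs
    unfolding v_def by (intro bounded_range_average ub)
  have u_t: "pair_mean (\<lambda>p. u x p * t a b p) = \<phi> (x \<otimes> a) * \<phi> (x \<otimes> b)"
    if "x \<in> carrier G" "a \<in> carrier G" "b \<in> carrier G" for x a b
  proof -
    have "pair_mean (\<lambda>p. u x p * t a b p) = pair_mean (\<lambda>(y, z).
        (indicat_real A (x \<otimes> y) * indicat_real A (inv a \<otimes> y)) * (indicat_real A (x \<otimes> z) * indicat_real A (inv b \<otimes> z)))"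
      by (intro arg_cong[where f = pair_mean] ext) (auto simp: u_def t_def)
    also have "\<dots> = \<phi> (x \<otimes> a) * \<phi> (x \<otimes> b)"
      using that by (subst pair_mean_times) (auto intro!: bounded_intros simp: \<phi>_def correlation_eq)
    finally show ?thesis .
  qed
  have v_t: "pair_mean (\<lambda>p. v xs p * t a b p) = average (\<lambda>x. \<phi> (x \<otimes> a) * \<phi> (x \<otimes> b)) xs"
    if "set xs \<subseteq> carrier G" "a \<in> carrier G" "b \<in> carrier G" for xs a b
  proof -
    have "pair_mean (\<lambda>p. v xs p * t a b p) = pair_mean (\<lambda>p. average (\<lambda>x. u x p * t a b p) xs)"
      by (simp add: v_def average_mult)
    also have "\<dots> = average (\<lambda>x. pair_mean (\<lambda>p. u x p * t a b p)) xs"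
      by (intro mean_average[OF mean_on_pair_mean] bounded_intros ub tb)
    also have "\<dots> = average (\<lambda>x. \<phi> (x \<otimes> a) * \<phi> (x \<otimes> b)) xs"
      using that u_t by (intro average_cong) (simp add: subset_iff)
    finally show ?thesis .
  qed
  obtain xs where xs: "xs \<noteq> []" "set xs \<subseteq> carrier G"
    and near: "\<forall>ys t. set ys \<subseteq> carrier G \<longrightarrow> length ys = length xs \<longrightarrow>
      pair_mean (\<lambda>p. (v ys p)\<^sup>2) = pair_mean (\<lambda>p. (v xs p)\<^sup>2) \<longrightarrow> (\<forall>p. \<bar>t p\<bar> \<le> 1) \<longrightarrow>
      \<bar>pair_mean (\<lambda>p. v xs p * t p) - pair_mean (\<lambda>p. v ys p * t p)\<bar> \<le> \<epsilon>"
    using near_minimal_average[where u = u, OF mean_on_pair_mean ub carrier_not_empty \<epsilon>,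
        folded v_def] by (elim exE conjE) (rule that)
  have "\<bar>average (\<lambda>x. \<phi> (x \<otimes> a) * \<phi> (x \<otimes> b)) xs - average (\<lambda>x. \<phi> (x \<otimes> l \<otimes> a) * \<phi> (x \<otimes> l \<otimes> b)) xs\<bar> \<le> \<epsilon>"
    if l: "l \<in> carrier G" and a: "a \<in> carrier G" and b: "b \<in> carrier G" for l a b
  proof -
    let ?ys = "map (\<lambda>x. x \<otimes> l) xs"
    have ys: "set ?ys \<subseteq> carrier G" using xs l by auto
    have "v ?ys (y, z) = v xs (l \<otimes> y, l \<otimes> z)" if "y \<in> carrier G" "z \<in> carrier G" for y z
      unfolding v_def average_map using xs l that
      by (intro average_cong) (simp add: u_def m_assoc subset_iff)
    then have "pair_mean (\<lambda>p. (v ?ys p)\<^sup>2) = pair_mean (\<lambda>(y, z). (v xs (l \<otimes> y, l \<otimes> z))\<^sup>2)"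
      using bounded_range_comp[OF vb, of xs "\<lambda>(y, z). (l \<otimes> y, l \<otimes> z)"]
      by (intro mean_cong[OF mean_on_pair_mean])
        (auto intro!: bounded_intros vb simp: case_prod_unfold)
    also have "\<dots> = pair_mean (\<lambda>p. (v xs p)\<^sup>2)"
      by (intro pair_mean_translate[OF l, of "\<lambda>p. (v xs p)\<^sup>2"] bounded_intros vb)
    finally have "\<bar>pair_mean (\<lambda>p. v xs p * t a b p) - pair_mean (\<lambda>p. v ?ys p * t a b p)\<bar> \<le> \<epsilon>"
      using near ys t1 by simp
    then show ?thesis
      using v_t[OF xs(2) a b] v_t[OF ys a b] by (simp add: average_map)
  qed
  moreover have "\<exists>a\<in>carrier G. M (indicat_real A) ^ 4 \<le> average (\<lambda>x. \<phi> (x \<otimes> a) * \<phi> (x \<otimes> a)) xs"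
  proof -
    have "pair_mean (u x) = M (indicat_real A) * M (indicat_real A)" if "x \<in> carrier G" for x
      unfolding u_def using that
      by (subst pair_mean_times) (auto intro!: bounded_intros simp: translate bounded_range_indicator)
    then have "average (\<lambda>x. pair_mean (u x)) xs = average (\<lambda>_. M (indicat_real A) * M (indicat_real A)) xs"
      using xs by (intro average_cong) (simp add: subset_iff)
    moreover have "pair_mean (v xs) = average (\<lambda>x. pair_mean (u x)) xs"
      unfolding v_def by (intro mean_average[OF mean_on_pair_mean] ub)
    ultimately have "pair_mean (v xs) = M (indicat_real A) * M (indicat_real A)"
      using xs(1) by (simp add: average_const)
    then have "M (indicat_real A) ^ 4 = (pair_mean (\<lambda>p. v xs p * 1))\<^sup>2"
      by (simp add: power2_eq_square power4_eq_xxxx)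
    also have "\<dots> \<le> pair_mean (\<lambda>p. (v xs p)\<^sup>2)"
      by (intro mean_Cauchy_Schwarz[OF mean_on_pair_mean] vb bounded_intros) simp
    also have "\<dots> = pair_mean (\<lambda>p. average (\<lambda>y. v xs p * u y p) xs)"
      by (simp add: v_def[of xs] average_mult[symmetric] power2_eq_square mult.commute)
    also have "\<dots> = average (\<lambda>y. pair_mean (\<lambda>p. v xs p * u y p)) xs"
      by (intro mean_average[OF mean_on_pair_mean] bounded_intros vb ub)
    also have "\<dots> = average (\<lambda>y. average (\<lambda>x. \<phi> (x \<otimes> inv y) * \<phi> (x \<otimes> inv y)) xs) xs"
    proof (rule average_cong)
      fix y assume "y \<in> set xs"
      then have y: "y \<in> carrier G" using xs by auto
      have "u y p = t (inv y) (inv y) p" for p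
        using y by (simp add: u_def t_def)
      then show "pair_mean (\<lambda>p. v xs p * u y p) = average (\<lambda>x. \<phi> (x \<otimes> inv y) * \<phi> (x \<otimes> inv y)) xs"
        using v_t[OF xs(2), of "inv y" "inv y"] y by simp
    qed
    finally show ?thesis
      using ex_ge_average[OF xs(1), of "\<lambda>y. average (\<lambda>x. \<phi> (x \<otimes> inv y) * \<phi> (x \<otimes> inv y)) xs"] xs(2)
      by (meson inv_closed order_trans subsetD)
  qed
  ultimately show ?thesis using xs by blast
qed

end

section \<open>The mean of the correlation function over the second set\<close>

lemma finite_net_of_finite_image:
  assumes "finite (\<kappa> ` X)"
  shows "\<exists>N. finite N \<and> N \<subseteq> X \<and> (\<forall>x\<in>X. \<exists>n\<in>N. \<kappa> n = \<kappa> x)"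
proof (intro exI conjI ballI)
  let ?N = "inv_into X \<kappa> ` \<kappa> ` X"
  show "finite ?N" using assms by simp
  show "?N \<subseteq> X" by (auto intro: inv_into_into)
  fix x assume "x \<in> X"
  then show "\<exists>n\<in>?N. \<kappa> n = \<kappa> x" by (intro bexI[of _ "inv_into X \<kappa> (\<kappa> x)"]) (auto simp: f_inv_into_f)
qed

lemma abs_sum_list_diff_le:
  assumes "\<And>c h. (c, h) \<in> set cs \<Longrightarrow> \<bar>p h - q h\<bar> \<le> (e :: real)"
  shows "\<bar>(\<Sum>(c, h)\<leftarrow>cs. c * p h) - (\<Sum>(c, h)\<leftarrow>cs. c * q h)\<bar> \<le> (\<Sum>(c, h)\<leftarrow>cs. \<bar>c\<bar>) * e"
  using assms
proof (induction cs)
  case (Cons i cs)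
  obtain c h where i: "i = (c, h)" by (cases i)
  have "\<bar>c * p h - c * q h\<bar> \<le> \<bar>c\<bar> * e"
    using Cons.prems[of c h] i by (simp add: right_diff_distrib[symmetric] abs_mult mult_left_mono)
  moreover have "\<bar>(\<Sum>(c, h)\<leftarrow>cs. c * p h) - (\<Sum>(c, h)\<leftarrow>cs. c * q h)\<bar> \<le> (\<Sum>(c, h)\<leftarrow>cs. \<bar>c\<bar>) * e"
    by (rule Cons.IH) (use Cons.prems in auto)
  ultimately show ?case by (simp add: i distrib_right)
qed simp

locale two_invariant_means = A: invariant_mean G \<mu> + B: invariant_mean G \<nu>
  for G (structure) and \<mu> \<nu> :: "('a \<Rightarrow> real) \<Rightarrow> real" +
  fixes A B :: "'a set"
begin

abbreviation \<phi> :: "'a \<Rightarrow> real" where "\<phi> \<equiv> correlation G \<mu> A"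

lemma phi_bounded: "bounded (range (\<lambda>x. \<phi> (f x)))"
  by (rule bounded_rangeI[of _ 1]) (use A.correlation_bounds in \<open>simp add: abs_le_iff minus_le_iff order_trans[of _ 0]\<close>)

text \<open>
The Gram kernel of the right translates of \<open>\<phi>\<close> in the semi-inner product of \<open>\<nu>\<close>.
\<close>

definition \<Phi> :: "'a \<Rightarrow> 'a \<Rightarrow> real" where
  "\<Phi> a b = \<nu> (\<lambda>x. \<phi> (x \<otimes> a) * \<phi> (x \<otimes> b))"

text \<open>
The product of the indicator of \<open>B\<close> with a right translate of \<open>\<phi>\<close>; on the Bohr compactification it
corresponds to a convolution.
\<close>

definition \<psi> :: "'a \<Rightarrow> real" where
  "\<psi> g = \<nu> (\<lambda>b. indicat_real B b * \<phi> (b \<otimes> g))"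

text \<open>
The \<open>\<nu>\<close>-mean over \<open>l\<close> of \<open>\<phi>(xla) \<phi>(xlb)\<close> is \<open>\<Phi> a b\<close> for every \<open>x\<close>, so averaging the stability
statement over \<open>l\<close> compares the finite average with \<open>\<Phi>\<close>, uniformly in \<open>a\<close> and \<open>b\<close>.
\<close>

lemma Phi_average:
  assumes \<epsilon>: "\<epsilon> > 0"
  shows "\<exists>xs. xs \<noteq> [] \<and> set xs \<subseteq> carrier G \<and>
    (\<forall>a\<in>carrier G. \<forall>b\<in>carrier G. \<bar>average (\<lambda>x. \<phi> (x \<otimes> a) * \<phi> (x \<otimes> b)) xs - \<Phi> a b\<bar> \<le> \<epsilon>) \<and>
    (\<forall>l\<in>carrier G. \<forall>a\<in>carrier G. \<forall>b\<in>carrier G.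
       \<bar>average (\<lambda>x. \<phi> (x \<otimes> a) * \<phi> (x \<otimes> b)) xs - average (\<lambda>x. \<phi> (x \<otimes> l \<otimes> a) * \<phi> (x \<otimes> l \<otimes> b)) xs\<bar> \<le> \<epsilon>) \<and>
    (\<exists>a\<in>carrier G. \<mu> (indicat_real A) ^ 4 \<le> average (\<lambda>x. \<phi> (x \<otimes> a) * \<phi> (x \<otimes> a)) xs)"
proof -
  obtain xs where xs: "xs \<noteq> []" "set xs \<subseteq> carrier G"
    and shift: "\<forall>l\<in>carrier G. \<forall>a\<in>carrier G. \<forall>b\<in>carrier G.
       \<bar>average (\<lambda>x. \<phi> (x \<otimes> a) * \<phi> (x \<otimes> b)) xs - average (\<lambda>x. \<phi> (x \<otimes> l \<otimes> a) * \<phi> (x \<otimes> l \<otimes> b)) xs\<bar> \<le> \<epsilon>"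
    and pos: "\<exists>a\<in>carrier G. \<mu> (indicat_real A) ^ 4 \<le> average (\<lambda>x. \<phi> (x \<otimes> a) * \<phi> (x \<otimes> a)) xs"
    using A.translation_stable_average[OF \<epsilon>, of A] by (elim exE conjE) (rule that)
  have "\<bar>average (\<lambda>x. \<phi> (x \<otimes> a) * \<phi> (x \<otimes> b)) xs - \<Phi> a b\<bar> \<le> \<epsilon>"
    if a: "a \<in> carrier G" and b: "b \<in> carrier G" for a b
  proof -
    let ?c = "average (\<lambda>x. \<phi> (x \<otimes> a) * \<phi> (x \<otimes> b)) xs"
    have "\<bar>\<nu> (\<lambda>_. ?c) - \<nu> (\<lambda>l. average (\<lambda>x. \<phi> (x \<otimes> l \<otimes> a) * \<phi> (x \<otimes> l \<otimes> b)) xs)\<bar> \<le> \<epsilon>"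
      using shift a b by (intro mean_close[OF B.mean] B.bounded_intros phi_bounded) auto
    moreover have "\<nu> (\<lambda>l. average (\<lambda>x. \<phi> (x \<otimes> l \<otimes> a) * \<phi> (x \<otimes> l \<otimes> b)) xs)
        = average (\<lambda>x. \<nu> (\<lambda>l. \<phi> (x \<otimes> l \<otimes> a) * \<phi> (x \<otimes> l \<otimes> b))) xs"
      by (intro mean_average[OF B.mean] B.bounded_intros phi_bounded)
    moreover have "average (\<lambda>x. \<nu> (\<lambda>l. \<phi> (x \<otimes> l \<otimes> a) * \<phi> (x \<otimes> l \<otimes> b))) xs = average (\<lambda>_. \<Phi> a b) xs"
    proof (rule average_cong)
      fix x assume "x \<in> set xs"
      then have "x \<in> carrier G" using xs by auto
      then show "\<nu> (\<lambda>l. \<phi> (x \<otimes> l \<otimes> a) * \<phi> (x \<otimes> l \<otimes> b)) = \<Phi> a b"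
        unfolding \<Phi>_def
        by (rule B.translate[of x "\<lambda>l. \<phi> (l \<otimes> a) * \<phi> (l \<otimes> b)"]) (intro B.bounded_intros phi_bounded)
    qed
    ultimately show ?thesis
      using xs(1) by (simp add: average_const mean_const[OF B.mean])
  qed
  then show ?thesis using xs shift pos by blast
qed

text \<open>
Left invariance of \<open>\<nu>\<close> alone does not give this, since the substitution needed is \<open>x \<mapsto> xy\<close>. It holds
because the approximating averages are almost unchanged by that substitution.
\<close>

lemma Phi_invariant:
  assumes "y \<in> carrier G" "a \<in> carrier G" "b \<in> carrier G"
  shows "\<Phi> (y \<otimes> a) (y \<otimes> b) = \<Phi> a b"
proof -
  have "\<bar>\<Phi> (y \<otimes> a) (y \<otimes> b) - \<Phi> a b\<bar> \<le> 0 + e" if e: "e > 0" for e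
  proof -
    have "e / 3 > 0" using e by simp
    then obtain xs where xs: "set xs \<subseteq> carrier G"
      and approx: "\<forall>a\<in>carrier G. \<forall>b\<in>carrier G. \<bar>average (\<lambda>x. \<phi> (x \<otimes> a) * \<phi> (x \<otimes> b)) xs - \<Phi> a b\<bar> \<le> e / 3"
      and shift: "\<forall>l\<in>carrier G. \<forall>a\<in>carrier G. \<forall>b\<in>carrier G.
         \<bar>average (\<lambda>x. \<phi> (x \<otimes> a) * \<phi> (x \<otimes> b)) xs - average (\<lambda>x. \<phi> (x \<otimes> l \<otimes> a) * \<phi> (x \<otimes> l \<otimes> b)) xs\<bar> \<le> e / 3"
      by (elim Phi_average[THEN exE] conjE) (rule that)
    have "average (\<lambda>x. \<phi> (x \<otimes> y \<otimes> a) * \<phi> (x \<otimes> y \<otimes> b)) xs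
        = average (\<lambda>x. \<phi> (x \<otimes> (y \<otimes> a)) * \<phi> (x \<otimes> (y \<otimes> b))) xs"
      using xs assms by (intro average_cong) (simp add: subset_iff A.m_assoc)
    moreover have "y \<otimes> a \<in> carrier G" "y \<otimes> b \<in> carrier G" using assms by auto
    ultimately show ?thesis
      using shift[rule_format, OF assms] approx[rule_format, OF assms(2,3)]
        approx[rule_format, of "y \<otimes> a" "y \<otimes> b"] by linarith
  qed
  then have "\<bar>\<Phi> (y \<otimes> a) (y \<otimes> b) - \<Phi> a b\<bar> \<le> 0" by (rule field_le_epsilon)
  then show ?thesis by simp
qed

lemma Phi_one_ge: "\<mu> (indicat_real A) ^ 4 \<le> \<Phi> \<one> \<one>"
proof (rule field_le_epsilon)
  fix e :: real assume e: "e > 0"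
  obtain xs a where a: "a \<in> carrier G"
    and approx: "\<bar>average (\<lambda>x. \<phi> (x \<otimes> a) * \<phi> (x \<otimes> a)) xs - \<Phi> a a\<bar> \<le> e"
    and pos: "\<mu> (indicat_real A) ^ 4 \<le> average (\<lambda>x. \<phi> (x \<otimes> a) * \<phi> (x \<otimes> a)) xs"
    using Phi_average[OF e] by blast
  have "\<Phi> a a = \<Phi> \<one> \<one>" using Phi_invariant[of a \<one> \<one>] a by simp
  then show "\<mu> (indicat_real A) ^ 4 \<le> \<Phi> \<one> \<one> + e" using approx pos by linarith
qed

text \<open>
Up to a small error the function \<open>\<Phi> a g\<close> depends on \<open>g\<close> only through the finitely many numbers
\<open>\<phi>(xg)\<close> in \<open>[0, 1]\<close>; rounding them gives finitely many classes.
\<close>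

lemma Phi_totally_bounded:
  assumes \<epsilon>: "\<epsilon> > 0"
  shows "\<exists>N. finite N \<and> N \<subseteq> carrier G \<and> (\<forall>g\<in>carrier G. \<exists>n\<in>N. \<forall>a\<in>carrier G. \<bar>\<Phi> a g - \<Phi> a n\<bar> \<le> \<epsilon>)"
proof -
  have "\<epsilon> / 3 > 0" using \<epsilon> by simp
  then obtain xs where xs: "xs \<noteq> []" "set xs \<subseteq> carrier G"
    and approx: "\<forall>a\<in>carrier G. \<forall>b\<in>carrier G. \<bar>average (\<lambda>x. \<phi> (x \<otimes> a) * \<phi> (x \<otimes> b)) xs - \<Phi> a b\<bar> \<le> \<epsilon> / 3"
    by (elim Phi_average[THEN exE] conjE) (rule that)
  define \<kappa> where "\<kappa> g = map (\<lambda>x. \<lfloor>3 * \<phi> (x \<otimes> g) / \<epsilon>\<rfloor>) xs" for g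
  have "\<kappa> g \<in> {ks. set ks \<subseteq> {0..\<lfloor>3 / \<epsilon>\<rfloor>} \<and> length ks = length xs}" for g
    using \<epsilon> A.correlation_bounds[of A] by (auto simp: \<kappa>_def intro!: floor_mono divide_right_mono)
  then have "finite (\<kappa> ` carrier G)"
    by (intro finite_subset[OF _ finite_lists_length_eq[of "{0..\<lfloor>3 / \<epsilon>\<rfloor>}" "length xs"]]) auto
  then obtain N where N: "finite N" "N \<subseteq> carrier G" "\<forall>g\<in>carrier G. \<exists>n\<in>N. \<kappa> n = \<kappa> g"
    using finite_net_of_finite_image by metis
  have close: "\<bar>\<Phi> a g - \<Phi> a n\<bar> \<le> \<epsilon>"
    if n: "n \<in> N" and g: "g \<in> carrier G" and eq: "\<kappa> n = \<kappa> g" and a: "a \<in> carrier G" for n g a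
  proof -
    have "\<bar>\<phi> (x \<otimes> a) * \<phi> (x \<otimes> g) - \<phi> (x \<otimes> a) * \<phi> (x \<otimes> n)\<bar> \<le> \<epsilon> / 3" if x: "x \<in> set xs" for x
    proof -
      have "\<lfloor>3 * \<phi> (x \<otimes> g) / \<epsilon>\<rfloor> = \<lfloor>3 * \<phi> (x \<otimes> n) / \<epsilon>\<rfloor>"
        using eq x by (simp add: \<kappa>_def)
      then have *: "\<bar>3 * \<phi> (x \<otimes> g) / \<epsilon> - 3 * \<phi> (x \<otimes> n) / \<epsilon>\<bar> \<le> 1" by linarith
      have "\<bar>\<phi> (x \<otimes> g) - \<phi> (x \<otimes> n)\<bar> \<le> \<epsilon> / 3"
      proof -
        have "\<bar>3 * \<phi> (x \<otimes> g) - 3 * \<phi> (x \<otimes> n)\<bar> \<le> \<epsilon>"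
          using * \<epsilon> by (simp add: diff_divide_distrib[symmetric] abs_divide divide_le_eq)
        then show ?thesis by linarith
      qed
      then have "\<bar>\<phi> (x \<otimes> a)\<bar> * \<bar>\<phi> (x \<otimes> g) - \<phi> (x \<otimes> n)\<bar> \<le> 1 * (\<epsilon> / 3)"
        using A.correlation_bounds[of A "x \<otimes> a"] by (intro mult_mono) auto
      then show ?thesis by (simp add: abs_mult[symmetric] right_diff_distrib)
    qed
    then have "\<bar>average (\<lambda>x. \<phi> (x \<otimes> a) * \<phi> (x \<otimes> g)) xs - average (\<lambda>x. \<phi> (x \<otimes> a) * \<phi> (x \<otimes> n)) xs\<bar> \<le> \<epsilon> / 3"
      unfolding average_diff[symmetric] using xs(1) by (intro abs_average_le)
    moreover have "n \<in> carrier G" using n N(2) by blast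
    ultimately show ?thesis
      using approx[rule_format, OF a g] approx[rule_format, OF a, of n] by linarith
  qed
  show ?thesis
  proof (intro exI[of _ N] conjI ballI)
    fix g assume g: "g \<in> carrier G"
    then obtain n where n: "n \<in> N" "\<kappa> n = \<kappa> g" using N(3) by blast
    show "\<exists>n\<in>N. \<forall>a\<in>carrier G. \<bar>\<Phi> a g - \<Phi> a n\<bar> \<le> \<epsilon>"
      by (rule bexI[OF _ n(1)], rule ballI, rule close[OF n(1) g n(2)])
  qed (use N in simp_all)
qed

text \<open>
Let \<open>f\<close> be a combination of translates of \<open>\<phi>\<close> whose distance from the indicator of \<open>B\<close> is nearly
least. The residual is then nearly orthogonal to every translate, uniformly because the translates have
norm at most \<open>1\<close>, and the products of \<open>f\<close> with the translates are combinations of values of \<open>\<Phi>\<close>.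
\<close>

lemma psi_near_Phi_span:
  assumes \<delta>: "\<delta> > 0"
  shows "\<exists>cs. snd ` set cs \<subseteq> carrier G \<and>
    (\<forall>g\<in>carrier G. \<bar>\<psi> g - (\<Sum>(c, h)\<leftarrow>cs. c * \<Phi> h g)\<bar> \<le> \<delta>)"
proof -
  define f where "f cs x = (\<Sum>(c, h)\<leftarrow>cs. c * \<phi> (x \<otimes> h))" for cs x
  define L where "L = {cs :: (real \<times> 'a) list. snd ` set cs \<subseteq> carrier G}"
  define r where "r cs x = indicat_real B x - f cs x" for cs x
  define J where "J cs = \<nu> (\<lambda>x. (r cs x)\<^sup>2)" for cs
  have fb: "bounded (range (f cs))" for cs
    unfolding f_def case_prod_unfold by (intro B.bounded_intros phi_bounded)
  have rb: "bounded (range (r cs))" for cs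
    unfolding r_def by (intro B.bounded_intros fb)
  have "J cs \<ge> 0" for cs
    unfolding J_def by (intro mean_nonneg[OF B.mean] B.bounded_intros rb) simp
  then have bdd: "bdd_below (J ` L)" by (intro bdd_belowI[of _ 0]) auto
  have "[] \<in> L" by (simp add: L_def)
  then obtain cs where cs: "cs \<in> L" "J cs < Inf (J ` L) + \<delta>\<^sup>2"
    using cINF_less_iff[OF _ bdd, of "Inf (J ` L) + \<delta>\<^sup>2"] \<delta> by auto
  have "\<bar>\<psi> g - (\<Sum>(c, h)\<leftarrow>cs. c * \<Phi> h g)\<bar> \<le> \<delta>" if g: "g \<in> carrier G" for g
  proof -
    let ?p = "\<lambda>x. \<phi> (x \<otimes> g)"
    \<comment> \<open>Adding t times the translate to the combination would lower the squared distance by at least t^2.\<close>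
    define t where "t = \<nu> (\<lambda>x. r cs x * ?p x)"
    have "(t, g) # cs \<in> L" using cs g by (simp add: L_def)
    then have "Inf (J ` L) \<le> J ((t, g) # cs)" by (intro cINF_lower bdd)
    also have "J ((t, g) # cs) = \<nu> (\<lambda>x. ((r cs x)\<^sup>2 - 2 * t * (r cs x * ?p x)) + t\<^sup>2 * (?p x)\<^sup>2)"
      unfolding J_def
      by (intro arg_cong[where f = \<nu>] ext) (simp add: r_def f_def power2_eq_square algebra_simps)
    also have "\<dots> = J cs - 2 * t * t + t\<^sup>2 * \<nu> (\<lambda>x. (?p x)\<^sup>2)"
      by (simp only: mean_add[OF B.mean] mean_diff[OF B.mean] mean_scale[OF B.mean] B.bounded_intros
          rb phi_bounded t_def J_def)
    also have "\<dots> \<le> J cs - 2 * t * t + t\<^sup>2 * 1"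
    proof -
      have "\<nu> (\<lambda>x. (?p x)\<^sup>2) \<le> \<nu> (\<lambda>_. 1)"
        using A.correlation_bounds[of A]
        by (intro mean_mono[OF B.mean] B.bounded_intros phi_bounded) (simp add: power_le_one)
      then show ?thesis by (simp add: mean_const[OF B.mean] mult_left_le)
    qed
    finally have "t\<^sup>2 \<le> \<delta>\<^sup>2" using cs(2) by (simp add: power2_eq_square)
    then have "\<bar>t\<bar> \<le> \<delta>" using \<delta> abs_le_square_iff[of t \<delta>] by simp
    moreover have "t = \<psi> g - (\<Sum>(c, h)\<leftarrow>cs. c * \<Phi> h g)"
    proof -
      have "t = \<nu> (\<lambda>x. indicat_real B x * ?p x - f cs x * ?p x)"
        by (simp add: t_def r_def left_diff_distrib)
      also have "\<dots> = \<psi> g - \<nu> (\<lambda>x. f cs x * ?p x)"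
        unfolding \<psi>_def by (intro mean_diff[OF B.mean] B.bounded_intros fb phi_bounded)
      also have "\<nu> (\<lambda>x. f cs x * ?p x) = \<nu> (\<lambda>x. \<Sum>i\<leftarrow>cs. fst i * (\<phi> (x \<otimes> snd i) * ?p x))"
        by (simp add: f_def case_prod_unfold sum_list_mult_const[symmetric] mult.assoc)
      also have "\<dots> = (\<Sum>i\<leftarrow>cs. \<nu> (\<lambda>x. fst i * (\<phi> (x \<otimes> snd i) * ?p x)))"
        by (intro mean_sum_list[OF B.mean] B.bounded_intros phi_bounded)
      also have "\<dots> = (\<Sum>(c, h)\<leftarrow>cs. c * \<Phi> h g)"
        by (simp add: \<Phi>_def case_prod_unfold mean_scale[OF B.mean] B.bounded_intros phi_bounded)
      finally show ?thesis .
    qed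
    ultimately show ?thesis by simp
  qed
  then show ?thesis using cs(1) by (auto simp: L_def)
qed

text \<open>
A left translation of \<open>g\<close> can be moved to the first argument of \<open>\<Phi>\<close>, and the net for \<open>\<Phi>\<close> works for
all first arguments simultaneously.
\<close>

lemma psi_almost_periodic:
  assumes \<epsilon>: "\<epsilon> > 0"
  shows "\<exists>N. finite N \<and> N \<subseteq> carrier G \<and>
    (\<forall>g\<in>carrier G. \<exists>n\<in>N. \<forall>a\<in>carrier G. \<bar>\<psi> (a \<otimes> g) - \<psi> (a \<otimes> n)\<bar> \<le> \<epsilon>)"
proof -
  obtain cs where cs: "snd ` set cs \<subseteq> carrier G"
    and approx: "\<forall>g\<in>carrier G. \<bar>\<psi> g - (\<Sum>(c, h)\<leftarrow>cs. c * \<Phi> h g)\<bar> \<le> \<epsilon> / 3"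
    using psi_near_Phi_span[of "\<epsilon> / 3"] \<epsilon> by auto
  define s where "s = (\<Sum>(c, h)\<leftarrow>cs. \<bar>c\<bar>)"
  have s: "s \<ge> 0" unfolding s_def by (intro sum_list_nonneg) auto
  define e where "e = \<epsilon> / (3 * (s + 1))"
  have e: "e > 0" "s * e \<le> \<epsilon> / 3" using s \<epsilon> by (simp_all add: e_def field_simps)
  obtain N where N: "finite N" "N \<subseteq> carrier G"
    and net: "\<forall>g\<in>carrier G. \<exists>n\<in>N. \<forall>a\<in>carrier G. \<bar>\<Phi> a g - \<Phi> a n\<bar> \<le> e"
    using Phi_totally_bounded[OF e(1)] by blast
  have close: "\<bar>\<psi> (a \<otimes> g) - \<psi> (a \<otimes> n)\<bar> \<le> \<epsilon>"
    if g: "g \<in> carrier G" and n: "n \<in> carrier G" and close: "\<forall>a\<in>carrier G. \<bar>\<Phi> a g - \<Phi> a n\<bar> \<le> e"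
      and a: "a \<in> carrier G" for g n a
  proof -
    have "\<bar>\<Phi> h (a \<otimes> g) - \<Phi> h (a \<otimes> n)\<bar> \<le> e" if "(c, h) \<in> set cs" for c h
    proof -
      have h: "h \<in> carrier G" using that cs by force
      have "\<Phi> (inv a \<otimes> h) (inv a \<otimes> (a \<otimes> x)) = \<Phi> h (a \<otimes> x)" if "x \<in> carrier G" for x
        using that a h by (intro Phi_invariant) auto
      moreover have "inv a \<otimes> (a \<otimes> x) = x" if "x \<in> carrier G" for x
        using that a by (simp add: A.m_assoc[symmetric])
      ultimately have "\<Phi> h (a \<otimes> x) = \<Phi> (inv a \<otimes> h) x" if "x \<in> carrier G" for x
        using that by simp
      then show ?thesis using g n close a h by simp
    qed
    then have "\<bar>(\<Sum>(c, h)\<leftarrow>cs. c * \<Phi> h (a \<otimes> g)) - (\<Sum>(c, h)\<leftarrow>cs. c * \<Phi> h (a \<otimes> n))\<bar> \<le> s * e"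
      unfolding s_def by (rule abs_sum_list_diff_le)
    moreover have "a \<otimes> g \<in> carrier G" "a \<otimes> n \<in> carrier G" using a g n by auto
    ultimately show ?thesis
      using e(2) approx[rule_format, of "a \<otimes> g"] approx[rule_format, of "a \<otimes> n"] by linarith
  qed
  show ?thesis
  proof (intro exI[of _ N] conjI ballI)
    fix g assume g: "g \<in> carrier G"
    then obtain n where n: "n \<in> N" "\<forall>a\<in>carrier G. \<bar>\<Phi> a g - \<Phi> a n\<bar> \<le> e" using net by blast
    show "\<exists>n\<in>N. \<forall>a\<in>carrier G. \<bar>\<psi> (a \<otimes> g) - \<psi> (a \<otimes> n)\<bar> \<le> \<epsilon>"
      by (rule bexI[OF _ n(1)], rule ballI, rule close[OF g subsetD[OF N(2) n(1)] n(2)])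
  qed (use N in simp_all)
qed

lemma psi_bounded: "bounded (range \<psi>)"
  unfolding \<psi>_def
  by (rule bounded_rangeI[of _ 1], intro mean_abs_le[OF B.mean] B.bounded_intros phi_bounded)
    (use A.correlation_bounds[of A] in \<open>simp add: indicator_def\<close>)

text \<open>
Since \<open>\<Phi>(a, a) = \<Phi>(1, 1)\<close>, the averages of \<open>\<phi>(xa)\<^sup>2 \<le> \<phi>(xa)\<close> over a suitable list are bounded below
by a constant \<open>k > 0\<close>. As \<open>\<phi>(xb\<inverse>) = \<phi>(bx\<inverse>)\<close>, this bounds the average of \<open>\<psi>\<close> over the
inverses of the list from below by \<open>k \<nu>(B)\<close>.
\<close>

lemma psi_pos_somewhere:
  assumes "\<mu> (indicat_real A) > 0" "\<nu> (indicat_real B) > 0"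
  shows "\<exists>g\<in>carrier G. \<psi> g > 0"
proof -
  define k where "k = \<Phi> \<one> \<one> / 2"
  have k: "k > 0" using Phi_one_ge assms(1) by (simp add: k_def) (meson less_le_trans zero_less_power)
  obtain xs where xs: "xs \<noteq> []" "set xs \<subseteq> carrier G"
    and approx: "\<forall>a\<in>carrier G. \<forall>b\<in>carrier G. \<bar>average (\<lambda>x. \<phi> (x \<otimes> a) * \<phi> (x \<otimes> b)) xs - \<Phi> a b\<bar> \<le> k"
    using Phi_average[OF k] by (elim exE conjE) (rule that)
  have "k \<le> average (\<lambda>x. \<phi> (b \<otimes> inv x)) xs" if b: "b \<in> carrier G" for b
  proof -
    have "\<Phi> (inv b) (inv b) = \<Phi> \<one> \<one>" using Phi_invariant[of "inv b" \<one> \<one>] b by simp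
    moreover have "\<bar>average (\<lambda>x. \<phi> (x \<otimes> inv b) * \<phi> (x \<otimes> inv b)) xs - \<Phi> (inv b) (inv b)\<bar> \<le> k"
      using approx b by simp
    ultimately have "k \<le> average (\<lambda>x. \<phi> (x \<otimes> inv b) * \<phi> (x \<otimes> inv b)) xs"
      unfolding k_def by linarith
    also have "\<dots> \<le> average (\<lambda>x. \<phi> (b \<otimes> inv x)) xs"
    proof (rule average_mono)
      fix x assume "x \<in> set xs"
      then have x: "x \<in> carrier G" using xs by auto
      have "\<phi> (b \<otimes> inv x) = \<phi> (x \<otimes> inv b)"
        using A.correlation_inv[of "x \<otimes> inv b" A] x b by (simp add: A.inv_mult_group)
      then show "\<phi> (x \<otimes> inv b) * \<phi> (x \<otimes> inv b) \<le> \<phi> (b \<otimes> inv x)"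
        using A.correlation_bounds[of A "x \<otimes> inv b"] by (simp add: mult_left_le)
    qed
    finally show ?thesis .
  qed
  then have "k * indicat_real B b \<le> average (\<lambda>x. indicat_real B b * \<phi> (b \<otimes> inv x)) xs"
    if "b \<in> carrier G" for b
    using that xs(1) by (cases "b \<in> B") (simp_all add: average_const)
  then have "\<nu> (\<lambda>b. k * indicat_real B b) \<le> \<nu> (\<lambda>b. average (\<lambda>x. indicat_real B b * \<phi> (b \<otimes> inv x)) xs)"
    by (intro mean_mono[OF B.mean] B.bounded_intros phi_bounded)
  also have "\<dots> = average (\<lambda>x. \<psi> (inv x)) xs"
    unfolding \<psi>_def by (intro mean_average[OF B.mean] B.bounded_intros phi_bounded)
  finally have "k * \<nu> (indicat_real B) \<le> average (\<lambda>x. \<psi> (inv x)) xs"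
    by (simp add: mean_scale[OF B.mean bounded_range_indicator])
  moreover have "0 < k * \<nu> (indicat_real B)" using k assms(2) by simp
  moreover obtain x where "x \<in> set xs" "average (\<lambda>x. \<psi> (inv x)) xs \<le> \<psi> (inv x)"
    using ex_ge_average[OF xs(1), of "\<lambda>x. \<psi> (inv x)"] by blast
  ultimately have "x \<in> set xs" "\<psi> (inv x) > 0" by linarith+
  then show ?thesis using xs(2) by (intro bexI[of _ "inv x"]) auto
qed

lemma psi_pos_imp_mem:
  assumes "A \<subseteq> carrier G" "B \<subseteq> carrier G" and g: "g \<in> carrier G" and pos: "\<psi> g > 0"
  shows "\<exists>b a1 a2. g = inv b \<otimes> a1 \<otimes> inv a2 \<and> b \<in> B \<and> a1 \<in> A \<and> a2 \<in> A"
proof -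
  have "\<exists>b\<in>carrier G. indicat_real B b * \<phi> (b \<otimes> g) \<noteq> 0"
  proof (rule ccontr)
    assume "\<not> ?thesis"
    then have "\<psi> g = \<nu> (\<lambda>_. 0)"
      unfolding \<psi>_def by (intro mean_cong[OF B.mean] B.bounded_intros phi_bounded) simp
    then show False using pos by (simp add: mean_const[OF B.mean])
  qed
  then obtain b where b: "b \<in> carrier G" "b \<in> B" "\<phi> (b \<otimes> g) \<noteq> 0"
    by (auto simp: indicator_def split: if_splits)
  have "\<exists>y\<in>carrier G. indicat_real A y * indicat_real A (inv (b \<otimes> g) \<otimes> y) \<noteq> 0"
  proof (rule ccontr)
    assume "\<not> ?thesis"
    then have "\<phi> (b \<otimes> g) = \<mu> (\<lambda>_. 0)"
      unfolding correlation_def by (intro mean_cong[OF A.mean] A.bounded_intros) simp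
    then show False using b(3) by (simp add: mean_const[OF A.mean])
  qed
  then obtain y where y: "y \<in> carrier G" "y \<in> A" "inv (b \<otimes> g) \<otimes> y \<in> A"
    by (auto simp: indicator_def split: if_splits)
  have cancel: "inv x \<otimes> (x \<otimes> z) = z" if "x \<in> carrier G" "z \<in> carrier G" for x z
    using that by (simp add: A.m_assoc[symmetric])
  have "inv b \<otimes> y \<otimes> inv (inv (b \<otimes> g) \<otimes> y) = inv b \<otimes> y \<otimes> (inv y \<otimes> (b \<otimes> g))"
    using b(1) g y(1) by (simp add: A.inv_mult_group)
  also have "\<dots> = inv b \<otimes> (y \<otimes> (inv y \<otimes> (b \<otimes> g)))"
    using b(1) g y(1) by (simp add: A.m_assoc)
  also have "\<dots> = g"
    using cancel[of "inv y" "b \<otimes> g"] cancel[of b g] b(1) g y(1) by simp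
  finally show ?thesis using b(2) y by metis
qed

end

section \<open>Bohr continuity of almost periodic functions\<close>

text \<open>
A map of the group to a complete metric space that induces a bi-invariant, totally bounded
pseudometric. The closure of its image is a compact group, whatever the ambient space is.
\<close>

locale translation_nonexpansive = group G for G :: "('a, 'm) monoid_scheme" (structure) +
  fixes e :: "'a \<Rightarrow> 'k :: complete_space"
  assumes left: "a \<in> carrier G \<Longrightarrow> g \<in> carrier G \<Longrightarrow> h \<in> carrier G \<Longrightarrow>
      dist (e (a \<otimes> g)) (e (a \<otimes> h)) \<le> dist (e g) (e h)"
    and right: "a \<in> carrier G \<Longrightarrow> g \<in> carrier G \<Longrightarrow> h \<in> carrier G \<Longrightarrow>
      dist (e (g \<otimes> a)) (e (h \<otimes> a)) \<le> dist (e g) (e h)"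
    and totally_bounded: "\<epsilon> > 0 \<Longrightarrow> \<exists>N. finite N \<and> (\<forall>g\<in>carrier G. \<exists>n\<in>N. dist (e n) (e g) < \<epsilon>)"
begin

lemma dist_mult:
  assumes "g \<in> carrier G" "h \<in> carrier G" "g' \<in> carrier G" "h' \<in> carrier G"
  shows "dist (e (g \<otimes> h)) (e (g' \<otimes> h')) \<le> dist (e g) (e g') + dist (e h) (e h')"
proof -
  have "dist (e (g \<otimes> h)) (e (g' \<otimes> h')) \<le> dist (e (g \<otimes> h)) (e (g' \<otimes> h)) + dist (e (g' \<otimes> h)) (e (g' \<otimes> h'))"
    by (rule dist_triangle)
  then show ?thesis
    using left[of g' h h'] right[of h g g'] assms by simp
qed

lemma dist_inv:
  assumes g: "g \<in> carrier G" and h: "h \<in> carrier G"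
  shows "dist (e (inv g)) (e (inv h)) \<le> dist (e g) (e h)"
proof -
  have "dist (e (inv g \<otimes> h \<otimes> inv h)) (e (inv g \<otimes> g \<otimes> inv h)) \<le> dist (e (inv g \<otimes> h)) (e (inv g \<otimes> g))"
    using g h by (intro right) auto
  also have "\<dots> \<le> dist (e h) (e g)"
    using g h by (intro left) auto
  finally show ?thesis using g h by (simp add: m_assoc dist_commute)
qed

definition completion :: "'k set" where "completion = closure (e ` carrier G)"

lemma e_completion: "g \<in> carrier G \<Longrightarrow> e g \<in> completion"
  unfolding completion_def using closure_subset[of "e ` carrier G"] by blast

text \<open>
A preimage; any choice serves, because points with the same image under \<open>e\<close> have products and inverses
with the same image.
\<close>

definition pick :: "'k \<Rightarrow> 'a" where "pick = inv_into (carrier G) e"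

lemma pick:
  assumes "u \<in> e ` carrier G"
  shows "pick u \<in> carrier G" "e (pick u) = u"
  using assms by (auto simp: pick_def inv_into_into f_inv_into_f)

text \<open>
By \<open>dist_mult\<close> the multiplication is Lipschitz on the dense set of values of \<open>e\<close>, so it extends
continuously to the closure.
\<close>

lemma completion_mult_exists:
  "\<exists>m. continuous_on (completion \<times> completion) m \<and>
    (\<forall>g\<in>carrier G. \<forall>h\<in>carrier G. m (e g, e h) = e (g \<otimes> h))"
proof -
  let ?E = "e ` carrier G"
  let ?f = "\<lambda>p. e (pick (fst p) \<otimes> pick (snd p))"
  have f: "?f (e g, e h) = e (g \<otimes> h)" if "g \<in> carrier G" "h \<in> carrier G" for g h
    using dist_mult[of "pick (e g)" "pick (e h)" g h] pick[of "e g"] pick[of "e h"] that by simp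
  have "dist (?f p) (?f q) \<le> dist (fst p) (fst q) + dist (snd p) (snd q)"
    if "p \<in> ?E \<times> ?E" "q \<in> ?E \<times> ?E" for p q
    using dist_mult[of "pick (fst p)" "pick (snd p)" "pick (fst q)" "pick (snd q)"] pick that
    by (simp add: mem_Times_iff)
  then have lip: "dist (?f p) (?f q) \<le> 2 * dist p q" if "p \<in> ?E \<times> ?E" "q \<in> ?E \<times> ?E" for p q
    using that dist_fst_le[of p q] dist_snd_le[of p q] by fastforce
  have "uniformly_continuous_on (?E \<times> ?E) ?f"
    unfolding uniformly_continuous_on_def
  proof (intro allI impI)
    fix \<epsilon> :: real assume "\<epsilon> > 0"
    then show "\<exists>d>0. \<forall>p\<in>?E \<times> ?E. \<forall>q\<in>?E \<times> ?E. dist q p < d \<longrightarrow> dist (?f q) (?f p) < \<epsilon>"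
      using lip by (intro exI[of _ "\<epsilon> / 2"]) fastforce
  qed
  then obtain m where "uniformly_continuous_on (closure (?E \<times> ?E)) m" "\<And>p. p \<in> ?E \<times> ?E \<Longrightarrow> ?f p = m p"
    by (rule uniformly_continuous_on_extension_on_closure) blast
  then show ?thesis
    using f by (intro exI[of _ m])
      (force simp: completion_def closure_Times dest: uniformly_continuous_imp_continuous)
qed

lemma completion_inv_exists:
  "\<exists>i. continuous_on completion i \<and> (\<forall>g\<in>carrier G. i (e g) = e (inv g))"
proof -
  let ?E = "e ` carrier G"
  let ?f = "\<lambda>p. e (inv (pick p))"
  have f: "?f (e g) = e (inv g)" if "g \<in> carrier G" for g
    using dist_inv[of "pick (e g)" g] pick[of "e g"] that by simp
  have lip: "dist (?f p) (?f q) \<le> dist p q" if "p \<in> ?E" "q \<in> ?E" for p q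
    using dist_inv[of "pick p" "pick q"] pick that by simp
  have "uniformly_continuous_on ?E ?f"
    unfolding uniformly_continuous_on_def
    using lip by (meson le_less_trans)
  then obtain m where "uniformly_continuous_on (closure ?E) m" "\<And>p. p \<in> ?E \<Longrightarrow> ?f p = m p"
    by (rule uniformly_continuous_on_extension_on_closure) blast
  then show ?thesis
    using f by (intro exI[of _ m]) (force simp: completion_def dest: uniformly_continuous_imp_continuous)
qed

lemma compact_completion: "compact completion"
  unfolding compact_eq_totally_bounded
proof (intro conjI allI impI)
  show "complete completion" by (simp add: completion_def complete_eq_closed)
  fix \<epsilon> :: real assume \<epsilon>: "\<epsilon> > 0"
  then obtain N where N: "finite N" "\<forall>g\<in>carrier G. \<exists>n\<in>N. dist (e n) (e g) < \<epsilon> / 2"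
    using totally_bounded[of "\<epsilon> / 2"] by auto
  have "\<exists>n\<in>N. dist (e n) u < \<epsilon>" if u: "u \<in> completion" for u
  proof -
    have "\<exists>y\<in>e ` carrier G. dist y u < \<epsilon> / 2"
      using u \<epsilon> unfolding completion_def closure_approachable by (meson half_gt_zero)
    then obtain g where g: "g \<in> carrier G" "dist (e g) u < \<epsilon> / 2" by blast
    obtain n where "n \<in> N" "dist (e n) (e g) < \<epsilon> / 2" using N g by blast
    then show ?thesis using g dist_triangle[of "e n" u "e g"] by (intro bexI[of _ n]) auto
  qed
  then show "\<exists>k. finite k \<and> completion \<subseteq> (\<Union>x\<in>k. ball x \<epsilon>)"
    using N(1) by (intro exI[of _ "e ` N"]) auto
qed

lemma completion_sequence:
  assumes "u \<in> completion"
  obtains s where "\<And>n. s n \<in> carrier G" "(\<lambda>n. e (s n)) \<longlonglongrightarrow> u"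
proof -
  obtain x where x: "\<And>n. x n \<in> e ` carrier G" "x \<longlonglongrightarrow> u"
    using assms unfolding completion_def closure_sequential by blast
  then show ?thesis
    using pick that[of "\<lambda>n. pick (x n)"] by simp
qed

text \<open>
The extended operations satisfy the group laws because these hold on a dense set and pass to limits of
sequences.
\<close>

lemma completion_group:
  obtains K :: "'k monoid" where "compact_Hausdorff_group K (top_of_set completion)" "e \<in> hom G K"
proof -
  obtain m where m: "continuous_on (completion \<times> completion) m"
    and m_e: "\<And>g h. g \<in> carrier G \<Longrightarrow> h \<in> carrier G \<Longrightarrow> m (e g, e h) = e (g \<otimes> h)"
    using completion_mult_exists by blast
  obtain i where i: "continuous_on completion i" and i_e: "\<And>g. g \<in> carrier G \<Longrightarrow> i (e g) = e (inv g)"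
    using completion_inv_exists by blast
  have closed: "u \<in> completion" if "\<And>n. s n \<in> carrier G" "(\<lambda>n. e (s n)) \<longlonglongrightarrow> u" for s u
    unfolding completion_def closure_sequential
    by (rule exI[of _ "\<lambda>n. e (s n)"]) (simp add: that)
  have m_lim: "(\<lambda>n. e (s n \<otimes> t n)) \<longlonglongrightarrow> m (u, v)"
    if s: "\<And>n. s n \<in> carrier G" "(\<lambda>n. e (s n)) \<longlonglongrightarrow> u" and t: "\<And>n. t n \<in> carrier G" "(\<lambda>n. e (t n)) \<longlonglongrightarrow> v" for s t u v
  proof -
    have "(\<lambda>n. m (e (s n), e (t n))) \<longlonglongrightarrow> m (u, v)"
      by (rule continuous_on_tendsto_compose[OF m]) (simp_all add: tendsto_Pair s t e_completion closed[OF s] closed[OF t])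
    then show ?thesis using s(1) t(1) by (simp add: m_e)
  qed
  have i_lim: "(\<lambda>n. e (inv (s n))) \<longlonglongrightarrow> i u"
    if s: "\<And>n. s n \<in> carrier G" "(\<lambda>n. e (s n)) \<longlonglongrightarrow> u" for s u
  proof -
    have "(\<lambda>n. i (e (s n))) \<longlonglongrightarrow> i u"
      by (rule continuous_on_tendsto_compose[OF i s(2)]) (simp_all add: s e_completion closed[OF s])
    then show ?thesis using s(1) by (simp add: i_e)
  qed
  have m_completion: "m (u, v) \<in> completion" if u: "u \<in> completion" and v: "v \<in> completion" for u v
  proof -
    obtain s where s: "\<And>n. s n \<in> carrier G" "(\<lambda>n. e (s n)) \<longlonglongrightarrow> u" using completion_sequence[OF u] by blast
    obtain t where t: "\<And>n. t n \<in> carrier G" "(\<lambda>n. e (t n)) \<longlonglongrightarrow> v" using completion_sequence[OF v] by blast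
    show ?thesis by (rule closed[OF _ m_lim[OF s t]]) (use s t in auto)
  qed
  have i_completion: "i u \<in> completion" if u: "u \<in> completion" for u
  proof -
    obtain s where s: "\<And>n. s n \<in> carrier G" "(\<lambda>n. e (s n)) \<longlonglongrightarrow> u" using completion_sequence[OF u] by blast
    show ?thesis by (rule closed[OF _ i_lim[OF s]]) (use s in auto)
  qed
  define K where "K = \<lparr>carrier = completion, monoid.mult = (\<lambda>u v. m (u, v)), one = e \<one>\<rparr>"
  have K[simp]: "carrier K = completion" "u \<otimes>\<^bsub>K\<^esub> v = m (u, v)" "\<one>\<^bsub>K\<^esub> = e \<one>" for u v
    by (simp_all add: K_def)
  have left_inv: "m (i u, u) = e \<one>" if u: "u \<in> completion" for u
  proof -
    obtain s where s: "\<And>n. s n \<in> carrier G" "(\<lambda>n. e (s n)) \<longlonglongrightarrow> u" using completion_sequence[OF u] by blast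
    have "(\<lambda>n. e (inv (s n) \<otimes> s n)) \<longlonglongrightarrow> m (i u, u)"
      by (rule m_lim[OF _ i_lim[OF s] s]) (use s in auto)
    then show ?thesis using s(1) by (simp add: LIMSEQ_const_iff)
  qed
  have group: "group K"
  proof (rule groupI)
    show "u \<otimes>\<^bsub>K\<^esub> v \<in> carrier K" if "u \<in> carrier K" "v \<in> carrier K" for u v
      using that m_completion by simp
    show "\<one>\<^bsub>K\<^esub> \<in> carrier K" by (simp add: e_completion)
    show "\<one>\<^bsub>K\<^esub> \<otimes>\<^bsub>K\<^esub> u = u" if u: "u \<in> carrier K" for u
    proof -
      obtain s where s: "\<And>n. s n \<in> carrier G" "(\<lambda>n. e (s n)) \<longlonglongrightarrow> u" using completion_sequence u by auto
      have "(\<lambda>n. e (\<one> \<otimes> s n)) \<longlonglongrightarrow> m (e \<one>, u)"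
        by (rule m_lim[OF _ _ s]) auto
      then have "(\<lambda>n. e (s n)) \<longlonglongrightarrow> m (e \<one>, u)" using s(1) by simp
      then have "m (e \<one>, u) = u" using s(2) by (rule LIMSEQ_unique)
      then show ?thesis by simp
    qed
    show "\<exists>v\<in>carrier K. v \<otimes>\<^bsub>K\<^esub> u = \<one>\<^bsub>K\<^esub>" if u: "u \<in> carrier K" for u
      using left_inv i_completion u by auto
    show "u \<otimes>\<^bsub>K\<^esub> v \<otimes>\<^bsub>K\<^esub> w = u \<otimes>\<^bsub>K\<^esub> (v \<otimes>\<^bsub>K\<^esub> w)"
      if u: "u \<in> carrier K" and v: "v \<in> carrier K" and w: "w \<in> carrier K" for u v w
    proof -
      obtain r where r: "\<And>n. r n \<in> carrier G" "(\<lambda>n. e (r n)) \<longlonglongrightarrow> u" using completion_sequence u by auto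
      obtain s where s: "\<And>n. s n \<in> carrier G" "(\<lambda>n. e (s n)) \<longlonglongrightarrow> v" using completion_sequence v by auto
      obtain t where t: "\<And>n. t n \<in> carrier G" "(\<lambda>n. e (t n)) \<longlonglongrightarrow> w" using completion_sequence w by auto
      have "(\<lambda>n. e (r n \<otimes> s n \<otimes> t n)) \<longlonglongrightarrow> m (m (u, v), w)"
        by (rule m_lim[OF _ m_lim[OF r s] t]) (use r s in auto)
      moreover have "(\<lambda>n. e (r n \<otimes> (s n \<otimes> t n))) \<longlonglongrightarrow> m (u, m (v, w))"
        by (rule m_lim[OF r _ m_lim[OF s t]]) (use s t in auto)
      ultimately have "m (m (u, v), w) = m (u, m (v, w))"
        using r(1) s(1) t(1) by (simp add: m_assoc LIMSEQ_unique)
      then show ?thesis by simp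
    qed
  qed
  have inv_K: "inv\<^bsub>K\<^esub> u = i u" if "u \<in> completion" for u
    using that left_inv i_completion by (intro group.inv_equality[OF group]) auto
  have mult_cont: "continuous_map (prod_topology (top_of_set completion) (top_of_set completion)) (top_of_set completion) (\<lambda>(u, v). u \<otimes>\<^bsub>K\<^esub> v)"
    using m m_completion
    by (auto simp: case_prod_unfold)
  have inv_cont: "continuous_map (top_of_set completion) (top_of_set completion) (\<lambda>u. inv\<^bsub>K\<^esub> u)"
    using continuous_on_cong[OF refl inv_K] i i_completion inv_K by (auto simp: continuous_map_in_subtopology)
  have "compact_Hausdorff_group K (top_of_set completion)"
    unfolding compact_Hausdorff_group_def topological_group_def
    by (intro conjI group mult_cont inv_cont)
      (simp_all add: compact_completion Hausdorff_space_subtopology compact_space_subtopology)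
  moreover have "e \<in> hom G K"
    by (rule homI) (auto simp: e_completion m_e)
  ultimately show ?thesis using that by blast
qed

text \<open>
By the universal property \<open>e\<close> factors through the Bohr compactification.
\<close>

theorem openin_bohr_topology_ball:
  "openin (bohr_topology G) {g \<in> carrier G. dist (e g\<^sub>0) (e g) < r}"
proof -
  obtain K :: "'k monoid" where K: "compact_Hausdorff_group K (top_of_set completion)" "e \<in> hom G K"
    using completion_group by blast
  obtain bG T \<eta> where b: "bohr_compactification G bG T \<eta>"
    using bohr_compactification_exists[OF is_group] by blast
  obtain h where h: "continuous_map T (top_of_set completion) h" "\<And>x. x \<in> carrier G \<Longrightarrow> h (\<eta> x) = e x"
    using factors_uniquely_ex[OF bohr_compactification_universal[OF is_group b K]] by metis
  let ?V = "{t \<in> topspace T. h t \<in> completion \<inter> ball (e g\<^sub>0) r}"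
  have "openin T ?V"
    by (rule openin_continuous_map_preimage[OF h(1)]) (simp add: openin_open_Int)
  moreover have "\<eta> g \<in> topspace T" if "g \<in> carrier G" for g
    using that bohr_compactificationD(1,2)[OF b] compact_Hausdorff_groupD(2) by (auto simp: hom_def)
  ultimately have "{g \<in> carrier G. dist (e g\<^sub>0) (e g) < r} = \<eta> -` ?V \<inter> carrier G"
    using h(2) e_completion by auto
  then show ?thesis
    unfolding bohr_topology_eq[OF b] openin_pullback_topology using \<open>openin T ?V\<close> by blast
qed

end

text \<open>
Send \<open>g\<close> to the family of all values \<open>\<psi>(agx)\<close>, as a bounded function of \<open>(a, x)\<close> with the uniform
metric. The net compares \<open>ag\<close> with \<open>an\<close> without a right factor \<open>x\<close>; total boundedness with this factor
follows by using the net twice, first to replace \<open>x\<close> by one of finitely many \<open>n\<close> and then to classify the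
elements \<open>gn\<close>.
\<close>

theorem almost_periodic_bohr_interior:
  fixes G (structure) and \<psi> :: "'a \<Rightarrow> real"
  assumes "group G" and bdd: "bounded (range \<psi>)"
    and ap: "\<And>\<epsilon>. \<epsilon> > 0 \<Longrightarrow> \<exists>N. finite N \<and> N \<subseteq> carrier G \<and>
      (\<forall>g\<in>carrier G. \<exists>n\<in>N. \<forall>a\<in>carrier G. \<bar>\<psi> (a \<otimes> g) - \<psi> (a \<otimes> n)\<bar> \<le> \<epsilon>)"
    and g0: "g\<^sub>0 \<in> carrier G" "\<psi> g\<^sub>0 > 0"
  shows "\<exists>U. openin (bohr_topology G) U \<and> g\<^sub>0 \<in> U \<and> (\<forall>g\<in>U. g \<in> carrier G \<and> \<psi> g > 0)"
proof -
  interpret group G by fact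
  \<comment> \<open>The discrete topology makes all bounded functions members of a complete space.\<close>
  define tr where "tr g p = (case of_discrete p of (a, x) \<Rightarrow>
      if a \<in> carrier G \<and> x \<in> carrier G then \<psi> (a \<otimes> g \<otimes> x) else 0)" for g and p :: "('a \<times> 'a) discrete"
  define e where "e g = Bcontfun (tr g)" for g
  obtain C where C: "C \<ge> 0" "\<And>x. \<bar>\<psi> x\<bar> \<le> C" using bounded_rangeE[OF bdd] by blast
  have "tr g \<in> bcontfun" for g
  proof -
    have "\<bar>tr g p\<bar> \<le> C" for p using C by (simp add: tr_def split: prod.split)
    then have "bounded (range (tr g))" by (rule bounded_rangeI)
    moreover have "continuous_on UNIV (tr g)"
      by (simp add: continuous_on_open_vimage open_discrete)
    ultimately show ?thesis by (simp add: bcontfun_def)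
  qed
  then have e: "apply_bcontfun (e g) p = tr g p" for g p
    by (simp add: e_def Bcontfun_inverse)
  have dist_le: "dist (e g) (e h) \<le> c"
    if c: "c \<ge> 0" "\<And>a x. a \<in> carrier G \<Longrightarrow> x \<in> carrier G \<Longrightarrow> \<bar>\<psi> (a \<otimes> g \<otimes> x) - \<psi> (a \<otimes> h \<otimes> x)\<bar> \<le> c" for g h c
    by (rule dist_bound) (use c in \<open>auto simp: e tr_def dist_real_def split: prod.split\<close>)
  have le_dist: "\<bar>\<psi> (a \<otimes> g \<otimes> x) - \<psi> (a \<otimes> h \<otimes> x)\<bar> \<le> dist (e g) (e h)"
    if "a \<in> carrier G" "x \<in> carrier G" for a x g h
    using dist_bounded[of "e g" "discrete (a, x)" "e h"] that
    by (simp add: e tr_def dist_real_def discrete_inverse)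
  interpret translation_nonexpansive G e
  proof
    fix a g h assume a: "a \<in> carrier G" and g: "g \<in> carrier G" and h: "h \<in> carrier G"
    show "dist (e (a \<otimes> g)) (e (a \<otimes> h)) \<le> dist (e g) (e h)"
    proof (rule dist_le)
      fix b x assume "b \<in> carrier G" "x \<in> carrier G"
      then show "\<bar>\<psi> (b \<otimes> (a \<otimes> g) \<otimes> x) - \<psi> (b \<otimes> (a \<otimes> h) \<otimes> x)\<bar> \<le> dist (e g) (e h)"
        using le_dist[of "b \<otimes> a" x g h] a g h by (simp add: m_assoc)
    qed simp
    show "dist (e (g \<otimes> a)) (e (h \<otimes> a)) \<le> dist (e g) (e h)"
    proof (rule dist_le)
      fix b x assume "b \<in> carrier G" "x \<in> carrier G"
      then show "\<bar>\<psi> (b \<otimes> (g \<otimes> a) \<otimes> x) - \<psi> (b \<otimes> (h \<otimes> a) \<otimes> x)\<bar> \<le> dist (e g) (e h)"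
        using le_dist[of b "a \<otimes> x" g h] a g h by (simp add: m_assoc)
    qed simp
  next
    fix \<epsilon> :: real assume \<epsilon>: "\<epsilon> > 0"
    define \<delta> where "\<delta> = \<epsilon> / 6"
    have \<delta>: "\<delta> > 0" using \<epsilon> by (simp add: \<delta>_def)
    obtain N where N: "finite N" "N \<subseteq> carrier G"
      and net: "\<forall>g\<in>carrier G. \<exists>n\<in>N. \<forall>a\<in>carrier G. \<bar>\<psi> (a \<otimes> g) - \<psi> (a \<otimes> n)\<bar> \<le> \<delta>"
      using ap[OF \<delta>] by blast
    obtain \<nu> where \<nu>: "\<And>g. g \<in> carrier G \<Longrightarrow> \<nu> g \<in> N"
      "\<And>g a. g \<in> carrier G \<Longrightarrow> a \<in> carrier G \<Longrightarrow> \<bar>\<psi> (a \<otimes> g) - \<psi> (a \<otimes> \<nu> g)\<bar> \<le> \<delta>"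
      using bchoice[OF net[unfolded Bex_def]] by blast
    \<comment> \<open>The class of g records, for each net point n, a net point that stands for the product of g and n.\<close>
    define \<kappa> where "\<kappa> g = restrict (\<lambda>n. \<nu> (g \<otimes> n)) N" for g
    have "\<kappa> ` carrier G \<subseteq> N \<rightarrow>\<^sub>E N"
      using \<nu>(1) N(2) by (auto simp: \<kappa>_def)
    then have "finite (\<kappa> ` carrier G)"
      using N(1) finite_PiE[of N "\<lambda>_. N"] finite_subset by blast
    then obtain M where M: "finite M" "M \<subseteq> carrier G" "\<forall>g\<in>carrier G. \<exists>n\<in>M. \<kappa> n = \<kappa> g"
      using finite_net_of_finite_image by metis
    have close: "dist (e n) (e g) < \<epsilon>" if n: "n \<in> carrier G" and g: "g \<in> carrier G" and eq: "\<kappa> n = \<kappa> g" for n g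
    proof -
      have "dist (e n) (e g) \<le> 4 * \<delta>"
      proof (rule dist_le)
        fix a x assume a: "a \<in> carrier G" and x: "x \<in> carrier G"
        have xN: "\<nu> x \<in> N" "\<nu> x \<in> carrier G" using \<nu>(1)[OF x] N(2) by auto
        have 1: "\<bar>\<psi> (a \<otimes> h \<otimes> x) - \<psi> (a \<otimes> h \<otimes> \<nu> x)\<bar> \<le> \<delta>" if "h \<in> carrier G" for h
          using \<nu>(2)[OF x, of "a \<otimes> h"] a that by simp
        have 2: "\<bar>\<psi> (a \<otimes> h \<otimes> \<nu> x) - \<psi> (a \<otimes> \<nu> (h \<otimes> \<nu> x))\<bar> \<le> \<delta>" if "h \<in> carrier G" for h
          using \<nu>(2)[of "h \<otimes> \<nu> x" a] a xN that by (simp add: m_assoc)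
        have "\<nu> (n \<otimes> \<nu> x) = \<nu> (g \<otimes> \<nu> x)"
          using fun_cong[OF eq, of "\<nu> x"] xN by (simp add: \<kappa>_def)
        then show "\<bar>\<psi> (a \<otimes> n \<otimes> x) - \<psi> (a \<otimes> g \<otimes> x)\<bar> \<le> 4 * \<delta>"
          using 1[OF n] 1[OF g] 2[OF n] 2[OF g] by simp
      qed (use \<delta> in simp)
      then show ?thesis using \<epsilon> by (simp add: \<delta>_def)
    qed
    show "\<exists>N. finite N \<and> (\<forall>g\<in>carrier G. \<exists>n\<in>N. dist (e n) (e g) < \<epsilon>)"
    proof (intro exI[of _ M] conjI ballI)
      fix g assume g: "g \<in> carrier G"
      then obtain n where n: "n \<in> M" "\<kappa> n = \<kappa> g" using M(3) by blast
      show "\<exists>n\<in>M. dist (e n) (e g) < \<epsilon>"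
        by (rule bexI[OF _ n(1)], rule close[OF subsetD[OF M(2) n(1)] g n(2)])
    qed (rule M(1))
  qed
  \<comment> \<open>The value of the function at g differs from its value at g0 by at most the distance of their images.\<close>
  let ?U = "{g \<in> carrier G. dist (e g\<^sub>0) (e g) < \<psi> g\<^sub>0}"
  have "\<psi> g > 0" if "g \<in> ?U" for g
    using le_dist[of \<one> \<one> g\<^sub>0 g] g0 that by auto
  then show ?thesis
    using openin_bohr_topology_ball[of g\<^sub>0 "\<psi> g\<^sub>0"] g0 by (intro exI[of _ ?U]) auto
qed

section \<open>The interior of the product set\<close>

theorem corollary15p6:
  fixes G :: "('a, 'm) monoid_scheme" and A B :: "'a set"
  assumes "amenable_group G"
    and "A \<subseteq> carrier G" and "B \<subseteq> carrier G"
    and "sigma_R G A > 0" and "sigma_R G B > 0"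
  shows "bohr_topology G interior_of
           {inv\<^bsub>G\<^esub> b \<otimes>\<^bsub>G\<^esub> a1 \<otimes>\<^bsub>G\<^esub> inv\<^bsub>G\<^esub> a2 | b a1 a2. b \<in> B \<and> a1 \<in> A \<and> a2 \<in> A} \<noteq> {}"
proof -
  have G: "group G" by (rule amenable_group_imp_group[OF assms(1)])
  obtain \<mu> where \<mu>: "mean_on (carrier G) \<mu>" "left_invariant G \<mu>" "\<mu> (indicat_real A) > 0"
    using sigma_R_pos_imp_invariant_mean[OF assms(1,2,4)] by blast
  obtain \<nu> where \<nu>: "mean_on (carrier G) \<nu>" "left_invariant G \<nu>" "\<nu> (indicat_real B) > 0"
    using sigma_R_pos_imp_invariant_mean[OF assms(1,3,5)] by blast
  interpret two_invariant_means G \<mu> \<nu> A B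
    using G \<mu> \<nu> by (simp add: two_invariant_means_def invariant_mean_def invariant_mean_axioms_def)
  obtain g\<^sub>0 where g0: "g\<^sub>0 \<in> carrier G" "\<psi> g\<^sub>0 > 0"
    using psi_pos_somewhere[OF \<mu>(3) \<nu>(3)] by blast
  obtain U where U: "openin (bohr_topology G) U" "g\<^sub>0 \<in> U" "\<forall>g\<in>U. g \<in> carrier G \<and> \<psi> g > 0"
    using almost_periodic_bohr_interior[OF G psi_bounded psi_almost_periodic g0] by blast
  have "U \<subseteq> {inv\<^bsub>G\<^esub> b \<otimes>\<^bsub>G\<^esub> a1 \<otimes>\<^bsub>G\<^esub> inv\<^bsub>G\<^esub> a2 | b a1 a2. b \<in> B \<and> a1 \<in> A \<and> a2 \<in> A}"
    using psi_pos_imp_mem[OF assms(2,3)] U(3) by blast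
  then show ?thesis
    using U(1,2) by (auto simp: interior_of_def)
qed

end
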